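(* Let $K$ be a commutative unital ring. Let $f:(X,d,\partial,t)\to(Y,d,\partial,t)$ and $g:(Y,d,\partial,t)\to(Z,d,\partial,t)$ be morphisms of $CF_\infty$-modules over $K$. Then their composition $gf=\{(gf)_{(i_1,\dots,i_k)}\}$ is a morphism of $CF_\infty$-modules $(X,d,\partial,t)\to(Z,d,\partial,t)$.
   Context: All modules are $K$-modules and all maps are $K$-linear. A differential (bigraded) module $(X,d)$ is a bigraded module $X=\{X_{n,m}\}_{n\ge 0,m\ge 0}$ with a differential $d:X_{*,\bullet}\to X_{*,\bullet-1}$ of bidegree $(0,-1)$, $d^2=0$. For a map $\varphi$ of bigraded modules of bidegree $(a,b)$ put $d(\varphi)=d\varphi-(-1)^{a+b}\varphi d$. Combinatorial notation. For integers $0\le i_1<\dots<i_k$ and a permutation $\sigma\in\Sigma_k$, let $(\sigma(i_1),\dots,\sigma(i_k))$ be the $k$-tuple obtained by permuting the components of $(i_1,\dots,i_k)$ by $\sigma$. Put $\widehat{\sigma(i_s)}=\sigma(i_s)-\alpha(\sigma(i_s))$, where $\alpha(\sigma(i_s))$ is the number of elements of $(\sigma(i_1),\dots,\sigma(i_k))$ to the right of $\sigma(i_s)$ that are smaller than $\sigma(i_s)$. Here $\mathrm{sign}(\sigma)\in\{0,1\}$ is the parity of (the number of inversions of) $\sigma$. $I_\sigma$ is the set of all partitions of $(\widehat{\sigma(i_1)},\dots,\widehat{\sigma(i_k)})$ into two tuples $(\widehat{\sigma(i_1)},\dots,\widehat{\sigma(i_m)})$ and $(\widehat{\sigma(i_{m+1})},\dots,\widehat{\sigma(i_k)})$,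 $1\le m\le k-1$, with $\widehat{\sigma(i_1)}<\dots<\widehat{\sigma(i_m)}$ and $\widehat{\sigma(i_{m+1})}<\dots<\widehat{\sigma(i_k)}$. $I'_\sigma$ is the analogous set with $0\le m\le k$ allowed (the empty tuple is written $(\,\,)$). An $F_\infty$-module $(X,d,\partial)$ is a differential module $(X,d)$ with maps $\partial=\{\partial_{(i_1,\dots,i_k)}:X_{n,\bullet}\to X_{n-k,\bullet+k-1}\}$, $1\le k\le n$, $0\le i_1<\dots<i_k\le n$, satisfying $$d(\partial_{(i_1,\dots,i_k)})=\sum_{\sigma\in\Sigma_k}\sum_{I_\sigma}(-1)^{\mathrm{sign}(\sigma)+1}\partial_{(\widehat{\sigma(i_1)},\dots,\widehat{\sigma(i_m)})}\,\partial_{(\widehat{\sigma(i_{m+1})},\dots,\widehat{\sigma(i_k)})}.$$ A $CF_\infty$-module $(X,d,\partial,t)$ is an $F_\infty$-module $(X,d,\partial)$ with maps $t=\{t_n:X_{n,\bullet}\to X_{n,\bullet}\}_{n\ge 0}$ such that $dt_n=t_nd$, $t_n^{n+1}=1$, and $\partial_{(i_1,\dots,i_k)}t_n=t_{n-k}\partial_{(i_1-1,\dots,i_k-1)}$ if $i_1>0$, $\partial_{(i_1,\dots,i_k)}t_n=(-1)^{k-1}\partial_{(i_2-1,\dots,i_k-1,n)}$ if $i_1=0$. A morphism of $F_\infty$-modules $f:(X,d,\partial)\to(Y,d,\partial)$ is a family $f=\{f_{(i_1,\dots,i_k)}:X_{n,\bullet}\to Y_{n-k,\bullet+k}\}$,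 $0\le k\le n$, $0\le i_1<\dots<i_k\le n$ (written $f_{(\,\,)}$ for $k=0$), such that $d(f_{(\,\,)})=0$ and for $k\ge 1$ $$d(f_{(i_1,\dots,i_k)})=-\partial_{(i_1,\dots,i_k)}f_{(\,\,)}+f_{(\,\,)}\partial_{(i_1,\dots,i_k)}+\sum_{\sigma\in\Sigma_k}\sum_{I_\sigma}(-1)^{\mathrm{sign}(\sigma)+1}\Big(\partial_{(\widehat{\sigma(i_1)},\dots,\widehat{\sigma(i_m)})}f_{(\widehat{\sigma(i_{m+1})},\dots,\widehat{\sigma(i_k)})}-f_{(\widehat{\sigma(i_1)},\dots,\widehat{\sigma(i_m)})}\partial_{(\widehat{\sigma(i_{m+1})},\dots,\widehat{\sigma(i_k)})}\Big).$$ The composition of morphisms of $F_\infty$-modules $f:(X,d,\partial)\to(Y,d,\partial)$, $g:(Y,d,\partial)\to(Z,d,\partial)$ is the morphism of $F_\infty$-modules $gf$ with components $$(gf)_{(i_1,\dots,i_k)}=\sum_{\sigma\in\Sigma_k}\sum_{I'_\sigma}(-1)^{\mathrm{sign}(\sigma)}g_{(\widehat{\sigma(i_1)},\dots,\widehat{\sigma(i_m)})}f_{(\widehat{\sigma(i_{m+1})},\dots,\widehat{\sigma(i_k)})},\qquad (gf)_{(\,\,)}=g_{(\,\,)}f_{(\,\,)}.$$ A morphism of $CF_\infty$-modules $f:(X,d,\partial,t)\to(Y,d,\partial,t)$ is a morphism of $F_\infty$-modules $f:(X,d,\partial)\to(Y,d,\partial)$ with $f_{(\,\,)}t_n=t_nf_{(\,\,)}$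 and, for $k\ge 1$, $f_{(i_1,\dots,i_k)}t_n=t_{n-k}f_{(i_1-1,\dots,i_k-1)}$ if $i_1>0$, $f_{(i_1,\dots,i_k)}t_n=(-1)^{k-1}f_{(i_2-1,\dots,i_k-1,n)}$ if $i_1=0$. Morphisms of $CF_\infty$-modules are composed as morphisms of $F_\infty$-modules. *)

theory Defs
  imports "HOL-Algebra.Module" "HOL-Combinatorics.Permutations"
begin

section \<open>Index tuples\<close>

text \<open>Tuples \<open>(i\<^sub>1, \<dots>, i\<^sub>k)\<close> are lists of naturals; list positions are counted from 0.\<close>

definition index_tuple :: "nat \<Rightarrow> nat list \<Rightarrow> bool" where
  "index_tuple n is \<longleftrightarrow> length is \<le> n \<and> sorted_wrt (<) is \<and> (\<forall>i\<in>set is. i \<le> n)"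

definition inversion_parity :: "nat \<Rightarrow> (nat \<Rightarrow> nat) \<Rightarrow> nat" where
  "inversion_parity k \<sigma> = card {(p, q). p < q \<and> q < k \<and> \<sigma> q < \<sigma> p} mod 2"

text \<open>The truncated subtraction below never truncates when the entries of the tuple are distinct.\<close>

definition hat :: "nat list \<Rightarrow> nat list" where
  "hat js = map (\<lambda>p. js ! p - card {q. p < q \<and> q < length js \<and> js ! q < js ! p}) [0..<length js]"

text \<open>The sets \<open>I\<^sub>\<sigma>\<close> and \<open>I'\<^sub>\<sigma>\<close> of partitions of the hatted tuple into two increasing tuples.\<close>

definition I_set :: "nat list \<Rightarrow> (nat \<Rightarrow> nat) \<Rightarrow> (nat list \<times> nat list) set" where
  "I_set is \<sigma> = (let h = hat (permute_list \<sigma> is) in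
     {(take m h, drop m h) | m. 1 \<le> m \<and> m + 1 \<le> length is \<and>
        sorted_wrt (<) (take m h) \<and> sorted_wrt (<) (drop m h)})"

definition I'_set :: "nat list \<Rightarrow> (nat \<Rightarrow> nat) \<Rightarrow> (nat list \<times> nat list) set" where
  "I'_set is \<sigma> = (let h = hat (permute_list \<sigma> is) in
     {(take m h, drop m h) | m. m \<le> length is \<and>
        sorted_wrt (<) (take m h) \<and> sorted_wrt (<) (drop m h)})"


section \<open>Bigraded modules and their maps\<close>

text \<open>\<open>(-1)\<^sup>s y\<close> in the abelian group \<open>M\<close>\<close>

definition signed :: "('k, 'a) module \<Rightarrow> int \<Rightarrow> 'a \<Rightarrow> 'a" where
  "signed M s y = (if even s then y else \<ominus>\<^bsub>M\<^esub> y)"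

definition K_linear :: "'k ring \<Rightarrow> ('k, 'a) module \<Rightarrow> ('k, 'b) module \<Rightarrow> ('a \<Rightarrow> 'b) \<Rightarrow> bool" where
  "K_linear K M N \<phi> \<longleftrightarrow>
     \<phi> \<in> carrier M \<rightarrow> carrier N \<and>
     (\<forall>x\<in>carrier M. \<forall>y\<in>carrier M. \<phi> (x \<oplus>\<^bsub>M\<^esub> y) = \<phi> x \<oplus>\<^bsub>N\<^esub> \<phi> y) \<and>
     (\<forall>c\<in>carrier K. \<forall>x\<in>carrier M. \<phi> (c \<odot>\<^bsub>M\<^esub> x) = c \<odot>\<^bsub>N\<^esub> \<phi> x)"

text \<open>
  A module \<open>X = {X\<^sub>n\<^sub>,\<^sub>m}\<close> graded by \<open>n, m \<ge> 0\<close>. The second degree ranges over the integers with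
  \<open>X\<^sub>n\<^sub>,\<^sub>m = 0\<close> for \<open>m < 0\<close>, so that maps which lower it, such as the differential on \<open>X\<^sub>n\<^sub>,\<^sub>0\<close>,
  have a target. Every family of maps carries the bidegree \<open>(n, m)\<close> of its source as arguments.
\<close>

locale bigraded_module = cring K for K :: "'k ring" +
  fixes X :: "nat \<Rightarrow> int \<Rightarrow> ('k, 'a) module"
  assumes component_module: "module K (X n m)"
    and negative_component: "m < 0 \<Longrightarrow> carrier (X n m) = {\<zero>\<^bsub>X n m\<^esub>}"

locale differential_module = bigraded_module K X
  for K :: "'k ring" and X :: "nat \<Rightarrow> int \<Rightarrow> ('k, 'a) module" +
  fixes d :: "nat \<Rightarrow> int \<Rightarrow> 'a \<Rightarrow> 'a"
  assumes d_linear: "K_linear K (X n m) (X n (m - 1)) (d n m)"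
    and d_squared: "x \<in> carrier (X n m) \<Longrightarrow> d n (m - 1) (d n m x) = \<zero>\<^bsub>X n (m - 2)\<^esub>"

text \<open>
  \<open>d(\<phi>) = d\<phi> - (-1)\<^sup>a\<^sup>+\<^sup>b \<phi>d\<close> for \<open>\<phi> : X \<rightarrow> Y\<close> of bidegree \<open>(a, b)\<close> with \<open>a = -k\<close>; the value on
  \<open>x \<in> X\<^sub>n\<^sub>,\<^sub>m\<close>, where \<open>k \<le> n\<close>, lies in \<open>Y\<^sub>n\<^sub>-\<^sub>k\<^sub>,\<^sub>m\<^sub>+\<^sub>b\<^sub>-\<^sub>1\<close>.
\<close>

definition d_of_map ::
  "(nat \<Rightarrow> int \<Rightarrow> 'a \<Rightarrow> 'a) \<Rightarrow> (nat \<Rightarrow> int \<Rightarrow> ('k, 'b) module) \<Rightarrow> (nat \<Rightarrow> int \<Rightarrow> 'b \<Rightarrow> 'b) \<Rightarrow>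
   nat \<Rightarrow> int \<Rightarrow> (nat \<Rightarrow> int \<Rightarrow> 'a \<Rightarrow> 'b) \<Rightarrow> nat \<Rightarrow> int \<Rightarrow> 'a \<Rightarrow> 'b" where
  "d_of_map dX Y dY k b \<phi> n m x =
     dY (n - k) (m + b) (\<phi> n m x)
       \<ominus>\<^bsub>Y (n - k) (m + b - 1)\<^esub>
     signed (Y (n - k) (m + b - 1)) (- int k + b) (\<phi> n (m - 1) (dX n m x))"


section \<open>Modules with infinity-simplicial faces\<close>

locale F_inf_module = differential_module K X d
  for K :: "'k ring" and X :: "nat \<Rightarrow> int \<Rightarrow> ('k, 'a) module" and d :: "nat \<Rightarrow> int \<Rightarrow> 'a \<Rightarrow> 'a" +
  fixes \<delta> :: "nat list \<Rightarrow> nat \<Rightarrow> int \<Rightarrow> 'a \<Rightarrow> 'a"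
  assumes \<delta>_linear:
    "\<lbrakk>index_tuple n is; is \<noteq> []; k = length is\<rbrakk> \<Longrightarrow>
      K_linear K (X n m) (X (n - k) (m + int k - 1)) (\<delta> is n m)"
    and \<delta>_relation:
    "\<lbrakk>index_tuple n is; is \<noteq> []; k = length is; x \<in> carrier (X n m)\<rbrakk> \<Longrightarrow>
      d_of_map d X d k (int k - 1) (\<delta> is) n m x =
      (\<Oplus>\<^bsub>X (n - k) (m + int k - 2)\<^esub>\<sigma>\<in>{\<sigma>. \<sigma> permutes {..<k}}.
       \<Oplus>\<^bsub>X (n - k) (m + int k - 2)\<^esub>uv\<in>I_set is \<sigma>. case uv of (u, v) \<Rightarrow>
         signed (X (n - k) (m + int k - 2)) (int (inversion_parity k \<sigma>) + 1)
           (\<delta> u (n - length v) (m + int (length v) - 1) (\<delta> v n m x)))"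

locale CF_inf_module = F_inf_module K X d \<delta>
  for K :: "'k ring" and X :: "nat \<Rightarrow> int \<Rightarrow> ('k, 'a) module" and d :: "nat \<Rightarrow> int \<Rightarrow> 'a \<Rightarrow> 'a"
    and \<delta> :: "nat list \<Rightarrow> nat \<Rightarrow> int \<Rightarrow> 'a \<Rightarrow> 'a" +
  fixes t :: "nat \<Rightarrow> int \<Rightarrow> 'a \<Rightarrow> 'a"
  assumes t_linear: "K_linear K (X n m) (X n m) (t n m)"
    and d_t: "x \<in> carrier (X n m) \<Longrightarrow> d n m (t n m x) = t n (m - 1) (d n m x)"
    and t_power: "x \<in> carrier (X n m) \<Longrightarrow> (t n m ^^ (n + 1)) x = x"
    and \<delta>_t_pos:
    "\<lbrakk>index_tuple n is; is \<noteq> []; k = length is; hd is > 0; x \<in> carrier (X n m)\<rbrakk> \<Longrightarrow>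
      \<delta> is n m (t n m x) = t (n - k) (m + int k - 1) (\<delta> (map (\<lambda>i. i - 1) is) n m x)"
    and \<delta>_t_zero:
    "\<lbrakk>index_tuple n is; is \<noteq> []; k = length is; hd is = 0; x \<in> carrier (X n m)\<rbrakk> \<Longrightarrow>
      \<delta> is n m (t n m x) =
      signed (X (n - k) (m + int k - 1)) (int k - 1) (\<delta> (map (\<lambda>i. i - 1) (tl is) @ [n]) n m x)"


section \<open>Morphisms and their composition\<close>

locale F_inf_morphism = X: F_inf_module K X dX \<delta>X + Y: F_inf_module K Y dY \<delta>Y
  for K :: "'k ring"
    and X :: "nat \<Rightarrow> int \<Rightarrow> ('k, 'a) module" and dX :: "nat \<Rightarrow> int \<Rightarrow> 'a \<Rightarrow> 'a"
    and \<delta>X :: "nat list \<Rightarrow> nat \<Rightarrow> int \<Rightarrow> 'a \<Rightarrow> 'a"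
    and Y :: "nat \<Rightarrow> int \<Rightarrow> ('k, 'b) module" and dY :: "nat \<Rightarrow> int \<Rightarrow> 'b \<Rightarrow> 'b"
    and \<delta>Y :: "nat list \<Rightarrow> nat \<Rightarrow> int \<Rightarrow> 'b \<Rightarrow> 'b" +
  fixes f :: "nat list \<Rightarrow> nat \<Rightarrow> int \<Rightarrow> 'a \<Rightarrow> 'b"
  assumes f_linear:
    "\<lbrakk>index_tuple n is; k = length is\<rbrakk> \<Longrightarrow>
      K_linear K (X n m) (Y (n - k) (m + int k)) (f is n m)"
    and f_empty: "x \<in> carrier (X n m) \<Longrightarrow> d_of_map dX Y dY 0 0 (f []) n m x = \<zero>\<^bsub>Y n (m - 1)\<^esub>"
    and f_relation:
    "\<lbrakk>index_tuple n is; is \<noteq> []; k = length is; x \<in> carrier (X n m)\<rbrakk> \<Longrightarrow>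
      d_of_map dX Y dY k (int k) (f is) n m x =
      \<ominus>\<^bsub>Y (n - k) (m + int k - 1)\<^esub> \<delta>Y is n m (f [] n m x)
      \<oplus>\<^bsub>Y (n - k) (m + int k - 1)\<^esub> f [] (n - k) (m + int k - 1) (\<delta>X is n m x)
      \<oplus>\<^bsub>Y (n - k) (m + int k - 1)\<^esub>
      (\<Oplus>\<^bsub>Y (n - k) (m + int k - 1)\<^esub>\<sigma>\<in>{\<sigma>. \<sigma> permutes {..<k}}.
       \<Oplus>\<^bsub>Y (n - k) (m + int k - 1)\<^esub>uv\<in>I_set is \<sigma>. case uv of (u, v) \<Rightarrow>
         signed (Y (n - k) (m + int k - 1)) (int (inversion_parity k \<sigma>) + 1)
           (\<delta>Y u (n - length v) (m + int (length v)) (f v n m x)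
            \<ominus>\<^bsub>Y (n - k) (m + int k - 1)\<^esub>
            f u (n - length v) (m + int (length v) - 1) (\<delta>X v n m x)))"

locale CF_inf_morphism =
  X: CF_inf_module K X dX \<delta>X tX + Y: CF_inf_module K Y dY \<delta>Y tY +
  F_inf_morphism K X dX \<delta>X Y dY \<delta>Y f
  for K :: "'k ring"
    and X :: "nat \<Rightarrow> int \<Rightarrow> ('k, 'a) module" and dX :: "nat \<Rightarrow> int \<Rightarrow> 'a \<Rightarrow> 'a"
    and \<delta>X :: "nat list \<Rightarrow> nat \<Rightarrow> int \<Rightarrow> 'a \<Rightarrow> 'a" and tX :: "nat \<Rightarrow> int \<Rightarrow> 'a \<Rightarrow> 'a"
    and Y :: "nat \<Rightarrow> int \<Rightarrow> ('k, 'b) module" and dY :: "nat \<Rightarrow> int \<Rightarrow> 'b \<Rightarrow> 'b"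
    and \<delta>Y :: "nat list \<Rightarrow> nat \<Rightarrow> int \<Rightarrow> 'b \<Rightarrow> 'b" and tY :: "nat \<Rightarrow> int \<Rightarrow> 'b \<Rightarrow> 'b"
    and f :: "nat list \<Rightarrow> nat \<Rightarrow> int \<Rightarrow> 'a \<Rightarrow> 'b" +
  assumes f_t_empty: "x \<in> carrier (X n m) \<Longrightarrow> f [] n m (tX n m x) = tY n m (f [] n m x)"
    and f_t_pos:
    "\<lbrakk>index_tuple n is; is \<noteq> []; k = length is; hd is > 0; x \<in> carrier (X n m)\<rbrakk> \<Longrightarrow>
      f is n m (tX n m x) = tY (n - k) (m + int k) (f (map (\<lambda>i. i - 1) is) n m x)"
    and f_t_zero:
    "\<lbrakk>index_tuple n is; is \<noteq> []; k = length is; hd is = 0; x \<in> carrier (X n m)\<rbrakk> \<Longrightarrow>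
      f is n m (tX n m x) =
      signed (Y (n - k) (m + int k)) (int k - 1) (f (map (\<lambda>i. i - 1) (tl is) @ [n]) n m x)"

text \<open>The composition \<open>gf : X \<rightarrow> Z\<close>; only the target modules enter, through the sums.\<close>

definition F_inf_compose ::
  "(nat \<Rightarrow> int \<Rightarrow> ('k, 'c) module) \<Rightarrow> (nat list \<Rightarrow> nat \<Rightarrow> int \<Rightarrow> 'b \<Rightarrow> 'c) \<Rightarrow>
   (nat list \<Rightarrow> nat \<Rightarrow> int \<Rightarrow> 'a \<Rightarrow> 'b) \<Rightarrow> nat list \<Rightarrow> nat \<Rightarrow> int \<Rightarrow> 'a \<Rightarrow> 'c" where
  "F_inf_compose Z g f is n m x =
     (if is = [] then g [] n m (f [] n m x)
      else let k = length is in
        (\<Oplus>\<^bsub>Z (n - k) (m + int k)\<^esub>\<sigma>\<in>{\<sigma>. \<sigma> permutes {..<k}}.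
         \<Oplus>\<^bsub>Z (n - k) (m + int k)\<^esub>uv\<in>I'_set is \<sigma>. case uv of (u, v) \<Rightarrow>
           signed (Z (n - k) (m + int k)) (int (inversion_parity k \<sigma>))
             (g u (n - length v) (m + int (length v)) (f v n m x))))"

end

theory Submission
  imports Defs "HOL-Algebra.AbelCoset"
begin

text \<open>
  The relations defining \<open>F\<^sub>\<infinity>\<close>-morphisms and their composition all have one shape. A split of the
  hatted tuple \<open>\<sigma>(i\<^sub>1), \<dots>, \<sigma>(i\<^sub>k)\<close> into two increasing tuples is the same thing as a subset \<open>B\<close> of
  \<open>S = {i\<^sub>1, \<dots>, i\<^sub>k}\<close>: the right tuple is \<open>B\<close> itself, the left tuple is \<open>A = S - B\<close> with every \<open>a\<close>
  replaced by its rank among the naturals outside \<open>B\<close>, and the sign counts the pairs \<open>b < a\<close>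
  (\<open>shuffles_bij_subsets\<close>). Hence the composition is a signed convolution product
  \<open>(g * f)\<^sub>S = \<Sum>\<^sub>B \<plusminus> g\<^sub>A\<^sub>|\<^sub>B f\<^sub>B\<close> of families of maps indexed by finite sets.

  This product is associative (\<open>conv_assoc\<close>): both bracketings are sums over ordered partitions of
  \<open>S\<close> into three blocks, since ranks outside \<open>C\<close> followed by ranks outside the image of \<open>B\<close> are ranks
  outside \<open>B \<union> C\<close>, and crossings are additive over blocks.

  Now collect the differential and the faces of \<open>X\<close> in one family \<open>D\<close>, with \<open>D = d\<close> at the empty
  set. The two terms of \<open>d(f\<^sub>S)\<close> then become the summands \<open>A = {}\<close> or \<open>B = {}\<close> that the sums over
  proper splits lack, and the morphism relations say \<open>D * f = f * D\<close>
  (\<open>F_inf_morphism_iff_intertwines\<close>). Closure under composition becomes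
  \<open>D * (g * f) = (D * g) * f = (g * D) * f = g * (D * f) = g * (f * D) = (g * f) * D\<close>.

  The cyclic condition involves a single rotation \<open>i \<mapsto> i - 1\<close> of the indices modulo \<open>n + 1\<close>. It is
  inherited by \<open>g * f\<close> term by term (\<open>equivariant_conv\<close>): if \<open>0 \<notin> S\<close> both factors commute with \<open>t\<close>;
  if \<open>0\<close> lies in \<open>A\<close> or in \<open>B\<close>, only the factor whose index contains \<open>0\<close> contributes a sign, and the
  change in the number of crossings supplies the rest of \<open>(-1)\<^sup>k\<^sup>-\<^sup>1\<close>.
\<close>

section \<open>Ranks in the complement of a set\<close>

definition rank_outside :: "nat set \<Rightarrow> nat \<Rightarrow> nat" where
  "rank_outside B a = card ({..<a} - B)"

text \<open>
  For disjoint \<open>A\<close> and \<open>B\<close>, the number of inversions of the sequence that lists \<open>A\<close> increasingly and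
  then \<open>B\<close> increasingly.
\<close>

definition crossings :: "nat set \<Rightarrow> nat set \<Rightarrow> nat" where
  "crossings A B = card {(a, b). a \<in> A \<and> b \<in> B \<and> b < a}"

text \<open>
  This links ranks to the hats: \<open>rank_outside B a\<close> is the entry \<open>a\<close> lowered by the number of smaller
  entries to its right, if \<open>B\<close> is the set of entries to its right. As a cardinality it is visibly
  monotone, and the truncated subtraction disappears from all later arguments.
\<close>

lemma rank_outside_eq_diff: "rank_outside B a = a - card {b \<in> B. b < a}"
proof -
  have eq: "{..<a} - B = {..<a} - {b \<in> B. b < a}"
    by auto
  have "finite {b \<in> B. b < a}"
    by (rule finite_subset[of _ "{..<a}"]) auto
  then show ?thesis
    unfolding rank_outside_def eq by (subst card_Diff_subset) auto
qed

lemma rank_outside_less: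
  assumes "a \<notin> B" "a < a'"
  shows "rank_outside B a < rank_outside B a'"
  unfolding rank_outside_def by (rule psubset_card_mono) (use assms in auto)

lemma rank_outside_less_iff:
  assumes "a \<notin> B" "a' \<notin> B"
  shows "rank_outside B a < rank_outside B a' \<longleftrightarrow> a < a'"
  using assms rank_outside_less by (metis linorder_neqE_nat order_less_asym)

lemma inj_on_rank_outside: "A \<inter> B = {} \<Longrightarrow> inj_on (rank_outside B) A"
  by (rule inj_onI) (metis disjoint_iff linorder_neqE_nat order_less_irrefl rank_outside_less)

lemma rank_outside_cong:
  "(\<And>x. x < a \<Longrightarrow> x \<in> B \<longleftrightarrow> x \<in> C) \<Longrightarrow> rank_outside B a = rank_outside C a"
  unfolding rank_outside_def by (rule arg_cong[where f = card]) auto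

lemma rank_outside_image_below:
  assumes "a \<notin> C"
  shows "rank_outside C ` ({..<a} - C) = {..<rank_outside C a}"
proof (rule card_subset_eq)
  show "rank_outside C ` ({..<a} - C) \<subseteq> {..<rank_outside C a}"
    using rank_outside_less by auto
  show "card (rank_outside C ` ({..<a} - C)) = card {..<rank_outside C a}"
    by (subst card_image[OF inj_on_rank_outside]) (auto simp: rank_outside_def)
qed simp

text \<open>
  Iterated hatting collapses: \<open>rank_outside C\<close> identifies the complement of \<open>C\<close> with the naturals,
  so discarding the image of \<open>B\<close> afterwards amounts to discarding \<open>B \<union> C\<close> at once. This is what makes
  the index tuples of the two bracketings of a triple product agree.
\<close>

lemma rank_outside_rank_outside:
  assumes "a \<notin> C" "B \<inter> C = {}"
  shows "rank_outside (rank_outside C ` B) (rank_outside C a) = rank_outside (B \<union> C) a"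
proof -
  have "{..<rank_outside C a} - rank_outside C ` B
      = rank_outside C ` ({..<a} - C) - rank_outside C ` B"
    by (simp add: rank_outside_image_below assms)
  also have "\<dots> = rank_outside C ` ({..<a} - C - B)"
    by (rule inj_on_image_set_diff[symmetric, OF inj_on_rank_outside[of "- C"]])
      (use assms in auto)
  finally have "rank_outside (rank_outside C ` B) (rank_outside C a)
      = card (rank_outside C ` ({..<a} - C - B))"
    by (simp add: rank_outside_def)
  also have "\<dots> = card ({..<a} - C - B)"
    by (rule card_image[OF inj_on_rank_outside]) auto
  also have "{..<a} - C - B = {..<a} - (B \<union> C)"
    by auto
  finally show ?thesis
    by (simp add: rank_outside_def)
qed

text \<open>
  Hatted tuples stay within the index range of the lower degree \<open>n - card B\<close>: of the \<open>n + 1\<close> indices,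
  the rank of \<open>a\<close> counts neither those in \<open>B\<close> nor \<open>a\<close> itself.
\<close>

lemma rank_outside_bound:
  assumes "a \<le> n" "B \<subseteq> {..n}" "a \<notin> B"
  shows "rank_outside B a \<le> n - card B"
proof -
  have "rank_outside B a \<le> card ({..n} - insert a B)"
    unfolding rank_outside_def by (rule card_mono) (use assms in auto)
  also have "\<dots> = n - card B"
    using assms finite_subset[OF assms(2)] by (subst card_Diff_subset) auto
  finally show ?thesis .
qed

lemma finite_crossings [simp]:
  "finite A \<Longrightarrow> finite B \<Longrightarrow> finite {(a, b). a \<in> A \<and> b \<in> B \<and> (b :: nat) < a}"
  by (rule finite_subset[of _ "A \<times> B"]) auto

lemma crossings_empty [simp]: "crossings A {} = 0" "crossings {} A = 0"
  by (simp_all add: crossings_def)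

lemma crossings_Un_left:
  assumes "finite A" "finite A'" "finite B" "A \<inter> A' = {}"
  shows "crossings (A \<union> A') B = crossings A B + crossings A' B"
proof -
  have "{(a, b). a \<in> A \<union> A' \<and> b \<in> B \<and> b < a}
      = {(a, b). a \<in> A \<and> b \<in> B \<and> b < a} \<union> {(a, b). a \<in> A' \<and> b \<in> B \<and> b < a}"
    by auto
  then show ?thesis
    unfolding crossings_def by (simp, subst card_Un_disjoint) (use assms in auto)
qed

lemma crossings_Un_right:
  assumes "finite A" "finite B" "finite B'" "B \<inter> B' = {}"
  shows "crossings A (B \<union> B') = crossings A B + crossings A B'"
proof -
  have "{(a, b). a \<in> A \<and> b \<in> B \<union> B' \<and> b < a}
      = {(a, b). a \<in> A \<and> b \<in> B \<and> b < a} \<union> {(a, b). a \<in> A \<and> b \<in> B' \<and> b < a}"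
    by auto
  then show ?thesis
    unfolding crossings_def by (simp, subst card_Un_disjoint) (use assms in auto)
qed

lemma crossings_image:
  assumes "\<And>a b. a \<in> A \<Longrightarrow> b \<in> B \<Longrightarrow> r b < r a \<longleftrightarrow> b < a" "inj_on r A" "inj_on r B"
  shows "crossings (r ` A) (r ` B) = crossings A B"
proof -
  have "{(a, b). a \<in> r ` A \<and> b \<in> r ` B \<and> b < a}
      = map_prod r r ` {(a, b). a \<in> A \<and> b \<in> B \<and> b < a}"
    using assms(1) by force
  moreover have "inj_on (map_prod r r) {(a, b). a \<in> A \<and> b \<in> B \<and> b < a}"
    by (rule inj_on_subset[OF map_prod_inj_on[OF assms(2,3)]]) auto
  ultimately show ?thesis
    by (simp add: crossings_def card_image)
qed

lemma crossings_rank_outside: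
  assumes "A \<inter> C = {}" "B \<inter> C = {}"
  shows "crossings (rank_outside C ` A) (rank_outside C ` B) = crossings A B"
  by (rule crossings_image) (use assms in \<open>auto intro!: inj_on_rank_outside rank_outside_less_iff\<close>)

section \<open>Permutations with sorted blocks are subsets\<close>

text \<open>
  Index tuples are increasing lists, hence determined by their sets of entries; all sums below are
  indexed by such sets, and \<open>tuple\<close> translates back.
\<close>

abbreviation tuple :: "nat set \<Rightarrow> nat list" where
  "tuple \<equiv> sorted_list_of_set"

lemma tuple_set: "sorted_wrt (<) xs \<Longrightarrow> tuple (set xs) = xs"
  by (rule sorted_list_of_set.idem_if_sorted_distinct) (auto simp: strict_sorted_iff)

lemma sorted_tuple: "sorted_wrt (<) (tuple S)"
  by (simp add: strict_sorted_iff)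

text \<open>
  The hat of an entry depends only on the entries to its right, so \<open>hat\<close> can be computed by
  recursion on the list.
\<close>

lemma hat_Cons:
  assumes "distinct (x # xs)"
  shows "hat (x # xs) = rank_outside (set xs) x # hat xs"
proof -
  have split: "[0..<length (x # xs)] = 0 # map Suc [0..<length xs]"
    by (metis length_Cons map_Suc_upt upt_conv_Cons zero_less_Suc)
  have head: "card {q. 0 < q \<and> q < length (x # xs) \<and> (x # xs) ! q < x} = card {b \<in> set xs. b < x}"
  proof (rule bij_betw_same_card[of "\<lambda>q. (x # xs) ! q"])
    show "bij_betw (\<lambda>q. (x # xs) ! q) {q. 0 < q \<and> q < length (x # xs) \<and> (x # xs) ! q < x}
       {b \<in> set xs. b < x}"
    proof (rule bij_betw_imageI)
      show "inj_on (\<lambda>q. (x # xs) ! q) {q. 0 < q \<and> q < length (x # xs) \<and> (x # xs) ! q < x}"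
        using assms by (auto intro!: inj_onI simp: nth_eq_iff_index_eq)
      show "(\<lambda>q. (x # xs) ! q) ` {q. 0 < q \<and> q < length (x # xs) \<and> (x # xs) ! q < x}
          = {b \<in> set xs. b < x}"
      proof (intro equalityI subsetI)
        fix b assume "b \<in> {b \<in> set xs. b < x}"
        then obtain i where "i < length xs" "xs ! i = b" "b < x"
          by (auto simp: in_set_conv_nth)
        then show "b \<in> (\<lambda>q. (x # xs) ! q) ` {q. 0 < q \<and> q < length (x # xs) \<and> (x # xs) ! q < x}"
          by (intro image_eqI[of _ _ "Suc i"]) auto
      qed (auto simp: nth_Cons')
    qed
  qed
  have tail: "{q. Suc p < q \<and> q < Suc (length xs) \<and> (x # xs) ! q < xs ! p}
      = Suc ` {q. p < q \<and> q < length xs \<and> xs ! q < xs ! p}" for p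
    by (auto simp: image_iff nth_Cons' gr0_conv_Suc less_Suc_eq_0_disj)
  show ?thesis
    unfolding hat_def split using head by (simp add: rank_outside_eq_diff tail card_image o_def)
qed

lemma hat_Nil [simp]: "hat [] = []"
  by (simp add: hat_def)

lemma length_hat [simp]: "length (hat js) = length js"
  by (simp add: hat_def)

lemma hat_append:
  assumes "sorted_wrt (<) xs" "sorted_wrt (<) ys" "set xs \<inter> set ys = {}"
  shows "hat (xs @ ys) = map (rank_outside (set ys)) xs @ ys"
  using assms
proof (induction xs)
  case Nil
  have "hat ys = ys" using Nil(2)
  proof (induction ys)
    case (Cons y ys)
    have "rank_outside (set ys) y = rank_outside {} y"
      by (rule rank_outside_cong) (use Cons.prems in auto)
    with Cons show ?case
      by (subst hat_Cons) (auto simp: strict_sorted_iff rank_outside_def)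
  qed simp
  then show ?case by simp
next
  case (Cons x xs)
  have "rank_outside (set (xs @ ys)) x = rank_outside (set ys) x"
    by (rule rank_outside_cong) (use Cons.prems in auto)
  moreover have "distinct (x # xs @ ys)"
    using Cons.prems by (auto simp: strict_sorted_iff)
  ultimately show ?case
    using Cons by (simp add: hat_Cons)
qed

text \<open>
  At a descent \<open>x > y\<close> the hat lowers \<open>x\<close> by more than \<open>y\<close>, namely by one for \<open>y\<close> and one for each later
  entry between them, at most \<open>x - y\<close> in all, so that \<open>x\<close> stays at or above \<open>y\<close>. At an ascent \<open>x < y\<close>
  it lowers \<open>y\<close> by at most \<open>y - x - 1\<close> more than \<open>x\<close>. Therefore a block of the hatted sequence is increasing precisely if the same
  block of the original sequence is, and only genuine shuffles contribute to the sums.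
\<close>

lemma hat_less_iff:
  assumes "distinct js" "Suc p < length js"
  shows "hat js ! p < hat js ! Suc p \<longleftrightarrow> js ! p < js ! Suc p"
  using assms
proof (induction js arbitrary: p)
  case (Cons x js)
  show ?case
  proof (cases p)
    case (Suc p')
    with Cons show ?thesis by (simp add: hat_Cons)
  next
    case 0
    with Cons.prems obtain y zs where js: "js = y # zs"
      by (cases js) auto
    have d: "x \<noteq> y" "x \<notin> set zs" "y \<notin> set zs" "distinct (y # zs)"
      using Cons.prems by (auto simp: js)
    have "rank_outside (insert y (set zs)) x < rank_outside (set zs) y \<longleftrightarrow> x < y"
    proof (cases "x < y")
      case True
      have "rank_outside (insert y (set zs)) x = rank_outside (set zs) x"
        by (rule rank_outside_cong) (use True in auto)
      then show ?thesis
        using True d by (simp add: rank_outside_less_iff)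
    next
      case False
      then have "{..<y} - set zs \<subseteq> {..<x} - insert y (set zs)"
        by auto
      then have "rank_outside (set zs) y \<le> rank_outside (insert y (set zs)) x"
        unfolding rank_outside_def by (intro card_mono) auto
      with False show ?thesis by simp
    qed
    then show ?thesis
      using Cons.prems d by (simp add: 0 js hat_Cons)
  qed
qed simp

lemma sorted_take_hat:
  assumes "distinct js"
  shows "sorted_wrt (<) (take m (hat js)) \<longleftrightarrow> sorted_wrt (<) (take m js)"
  by (auto simp: sorted_wrt_iff_nth_Suc_transp hat_less_iff[OF assms])

lemma sorted_drop_hat:
  assumes "distinct js"
  shows "sorted_wrt (<) (drop m (hat js)) \<longleftrightarrow> sorted_wrt (<) (drop m js)"
  by (auto simp: sorted_wrt_iff_nth_Suc_transp hat_less_iff[OF assms])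

lemma inversions_two_blocks:
  assumes "sorted_wrt (<) xs" "sorted_wrt (<) ys"
  shows "card {(p, q). p < q \<and> q < length (xs @ ys) \<and> (xs @ ys) ! q < (xs @ ys) ! p}
       = crossings (set xs) (set ys)"
proof -
  let ?js = "xs @ ys" and ?m = "length xs"
  let ?inv = "{(p, q). p < q \<and> q < length ?js \<and> ?js ! q < ?js ! p}"
  have blocks: "p < ?m \<and> ?m \<le> q" if "(p, q) \<in> ?inv" for p q
  proof (rule ccontr)
    assume "\<not> (p < ?m \<and> ?m \<le> q)"
    with that consider "q < ?m" | "?m \<le> p" by auto
    then show False
    proof cases
      case 1
      with that have "xs ! p < xs ! q"
        by (intro sorted_wrt_nth_less[OF assms(1)]) auto
      with that 1 show False by (auto simp: nth_append)
    next
      case 2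
      with that have "ys ! (p - ?m) < ys ! (q - ?m)"
        by (intro sorted_wrt_nth_less[OF assms(2)]) auto
      with that 2 show False by (auto simp: nth_append)
    qed
  qed
  have dist: "distinct xs" "distinct ys"
    using assms by (auto simp: strict_sorted_iff)
  have "bij_betw (\<lambda>(p, q). (xs ! p, ys ! (q - ?m))) ?inv
      {(a, b). a \<in> set xs \<and> b \<in> set ys \<and> b < a}"
  proof (rule bij_betw_imageI)
    show "inj_on (\<lambda>(p, q). (xs ! p, ys ! (q - ?m))) ?inv"
    proof (rule inj_onI, clarify)
      fix p q p' q'
      assume pq: "p < q" "q < length ?js" "?js ! q < ?js ! p"
        and pq': "p' < q'" "q' < length ?js" "?js ! q' < ?js ! p'"
        and eq: "xs ! p = xs ! p'" "ys ! (q - ?m) = ys ! (q' - ?m)"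
      have "p < ?m" "?m \<le> q" "p' < ?m" "?m \<le> q'"
        using blocks[of p q] blocks[of p' q'] pq pq' by auto
      moreover from this have "q - ?m = q' - ?m"
        using eq(2) pq(2) pq'(2) dist by (subst (asm) nth_eq_iff_index_eq) auto
      ultimately show "p = p' \<and> q = q'"
        using eq(1) dist by (auto simp: nth_eq_iff_index_eq)
    qed
    show "(\<lambda>(p, q). (xs ! p, ys ! (q - ?m))) ` ?inv = {(a, b). a \<in> set xs \<and> b \<in> set ys \<and> b < a}"
    proof (intro equalityI subsetI)
      fix z assume "z \<in> (\<lambda>(p, q). (xs ! p, ys ! (q - ?m))) ` ?inv"
      then obtain p q where pq: "(p, q) \<in> ?inv" "z = (xs ! p, ys ! (q - ?m))"
        by auto
      with blocks[OF pq(1)] show "z \<in> {(a, b). a \<in> set xs \<and> b \<in> set ys \<and> b < a}"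
        by (auto simp: nth_append)
    next
      fix z assume "z \<in> {(a, b). a \<in> set xs \<and> b \<in> set ys \<and> b < a}"
      then obtain p q where "p < length xs" "q < length ys" "ys ! q < xs ! p" "z = (xs ! p, ys ! q)"
        by (auto simp: in_set_conv_nth)
      then show "z \<in> (\<lambda>(p, q). (xs ! p, ys ! (q - ?m))) ` ?inv"
        by (intro image_eqI[of _ _ "(p, ?m + q)"]) (auto simp: nth_append)
    qed
  qed
  then show ?thesis
    unfolding crossings_def by (rule bij_betw_same_card)
qed

lemma inversion_parity_permute_list:
  fixes xs :: "nat list"
  assumes "sorted_wrt (<) xs" "\<sigma> permutes {..<length xs}"
  shows "inversion_parity (length xs) \<sigma> =
    card {(p, q). p < q \<and> q < length xs \<and> permute_list \<sigma> xs ! q < permute_list \<sigma> xs ! p} mod 2"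
proof -
  have less_iff: "xs ! i < xs ! j \<longleftrightarrow> i < j" if "i < length xs" "j < length xs" for i j
    using sorted_wrt_nth_less[OF assms(1), of i j] sorted_wrt_nth_less[OF assms(1), of j i] that
    by (cases i j rule: linorder_cases) (auto simp: order_less_imp_not_less)
  have "permute_list \<sigma> xs ! q < permute_list \<sigma> xs ! p \<longleftrightarrow> \<sigma> q < \<sigma> p"
    if "p < q" "q < length xs" for p q
    using that permutes_in_image[OF assms(2), of p] permutes_in_image[OF assms(2), of q]
    by (simp add: permute_list_nth[OF assms(2)] less_iff)
  then show ?thesis
    unfolding inversion_parity_def by (intro arg_cong[where f = "\<lambda>A. card A mod 2"]) auto
qed

text \<open>
  Everything that enters a summand, the two tuples, the permutation and the sign, is a function of
  the set of entries of the right tuple.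
\<close>

lemma I'_setD:
  assumes "sorted_wrt (<) is" "\<sigma> permutes {..<length is}" "(u, v) \<in> I'_set is \<sigma>"
  defines "A \<equiv> set is - set v"
  shows "set v \<subseteq> set is"
    and "v = tuple (set v)"
    and "u = tuple (rank_outside (set v) ` A)"
    and "permute_list \<sigma> is = tuple A @ tuple (set v)"
    and "inversion_parity (length is) \<sigma> = crossings A (set v) mod 2"
proof -
  define js where "js = permute_list \<sigma> is"
  have js: "distinct js" "set js = set is" "length js = length is"
    using assms(1,2) by (auto simp: js_def strict_sorted_iff)
  obtain m where uv: "u = take m (hat js)" "v = drop m (hat js)" "m \<le> length is"
      and "sorted_wrt (<) u" "sorted_wrt (<) v"
    using assms(3) by (auto simp: I'_set_def Let_def js_def)
  define xs ys where "xs = take m js" and "ys = drop m js"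
  have split: "js = xs @ ys" "length xs = m"
    using uv(3) js(3) by (auto simp: xs_def ys_def)
  have sorted: "sorted_wrt (<) xs" "sorted_wrt (<) ys"
    using \<open>sorted_wrt (<) u\<close> \<open>sorted_wrt (<) v\<close> uv js(1)
    by (simp_all add: xs_def ys_def sorted_take_hat sorted_drop_hat)
  have disj: "set xs \<inter> set ys = {}"
    using js(1) by (auto simp: split)
  have u: "u = map (rank_outside (set ys)) xs" and v: "v = ys"
    using uv by (simp_all add: split hat_append[OF sorted disj])
  have A: "A = set xs"
    using js(2) disj by (auto simp: A_def v split)
  show "set v \<subseteq> set is"
    using js(2) by (auto simp: v split)
  show "v = tuple (set v)"
    by (simp add: v tuple_set sorted)
  show "u = tuple (rank_outside (set v) ` A)"
    using tuple_set[OF \<open>sorted_wrt (<) u\<close>] by (simp add: u v A)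
  show "permute_list \<sigma> is = tuple A @ tuple (set v)"
    using split by (simp add: v A tuple_set sorted js_def)
  show "inversion_parity (length is) \<sigma> = crossings A (set v) mod 2"
    using inversion_parity_permute_list[OF assms(1,2)] inversions_two_blocks[OF sorted]
    by (simp add: split(1)[unfolded js_def] js(3)[symmetric] v A)
       (simp add: split(1) flip: js(3))
qed

lemma I'_setI:
  assumes "sorted_wrt (<) is" "B \<subseteq> set is"
  shows "\<exists>\<sigma> u. \<sigma> permutes {..<length is} \<and> (u, tuple B) \<in> I'_set is \<sigma>"
proof -
  let ?xs = "tuple (set is - B)" and ?ys = "tuple B"
  have fin: "finite B"
    using assms(2) finite_subset by auto
  then have sets: "set ?xs = set is - B" "set ?ys = B"
    by auto
  have dist: "distinct (?xs @ ?ys)" "distinct is"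
    using assms(1) by (auto simp: fin strict_sorted_iff)
  have "mset (?xs @ ?ys) = mset is"
    using dist assms(2) sets by (subst set_eq_iff_mset_eq_distinct[symmetric]) auto
  then obtain \<sigma> where \<sigma>: "\<sigma> permutes {..<length is}" "permute_list \<sigma> is = ?xs @ ?ys"
    by (rule mset_eq_permutation)
  have "hat (permute_list \<sigma> is) = map (rank_outside B) ?xs @ ?ys"
    unfolding \<sigma>(2) by (subst hat_append) (auto simp: sorted_tuple fin)
  moreover have "sorted_wrt (<) (map (rank_outside B) ?xs)"
    by (subst sorted_wrt_map, rule sorted_wrt_mono_rel[OF _ sorted_tuple])
       (auto intro: rank_outside_less)
  moreover have "length ?xs \<le> length is"
    using \<sigma>(2) length_permute_list[of \<sigma> "is"] by simp
  ultimately have "(map (rank_outside B) ?xs, ?ys) \<in> I'_set is \<sigma>"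
    by (auto simp: I'_set_def sorted_tuple intro!: exI[of _ "length ?xs"])
  with \<sigma> show ?thesis by blast
qed

lemma permute_list_inject:
  assumes "distinct xs" "\<sigma> permutes {..<length xs}" "\<tau> permutes {..<length xs}"
    and "permute_list \<sigma> xs = permute_list \<tau> xs"
  shows "\<sigma> = \<tau>"
proof
  fix p
  show "\<sigma> p = \<tau> p"
  proof (cases "p < length xs")
    case True
    then have "xs ! \<sigma> p = xs ! \<tau> p"
      by (metis assms(2,3,4) permute_list_nth)
    then show ?thesis
      using True assms(1) permutes_in_image[OF assms(2), of p] permutes_in_image[OF assms(3), of p]
      by (simp add: nth_eq_iff_index_eq)
  next
    case False
    then show ?thesis
      using assms(2,3) by (simp add: permutes_not_in)
  qed
qed

text \<open>
  The cut point need not be recorded: the right tuple consists of unhatted entries, so its length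
  and its set of entries can be read off.
\<close>

theorem shuffles_bij_subsets:
  assumes "sorted_wrt (<) is"
  shows "bij_betw (\<lambda>(\<sigma>, u, v). set v) (SIGMA \<sigma>:{\<sigma>. \<sigma> permutes {..<length is}}. I'_set is \<sigma>)
    (Pow (set is))"
proof (rule bij_betw_imageI)
  show "inj_on (\<lambda>(\<sigma>, u, v). set v) (SIGMA \<sigma>:{\<sigma>. \<sigma> permutes {..<length is}}. I'_set is \<sigma>)"
  proof (rule inj_onI)
    fix z w
    assume "z \<in> (SIGMA \<sigma>:{\<sigma>. \<sigma> permutes {..<length is}}. I'_set is \<sigma>)"
      and "w \<in> (SIGMA \<sigma>:{\<sigma>. \<sigma> permutes {..<length is}}. I'_set is \<sigma>)"
      and same: "(\<lambda>(\<sigma>, u, v). set v) z = (\<lambda>(\<sigma>, u, v). set v) w"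
    then obtain \<sigma> u v \<tau> u' v' where z: "z = (\<sigma>, u, v)" and w: "w = (\<tau>, u', v')"
      and \<sigma>: "\<sigma> permutes {..<length is}" "(u, v) \<in> I'_set is \<sigma>"
      and \<tau>: "\<tau> permutes {..<length is}" "(u', v') \<in> I'_set is \<tau>"
      by auto
    have eq: "set v = set v'"
      using same by (simp add: z w)
    note \<sigma>' = I'_setD[OF assms \<sigma>] and \<tau>' = I'_setD[OF assms \<tau>]
    have "\<sigma> = \<tau>"
      using permute_list_inject[OF _ \<sigma>(1) \<tau>(1)] \<sigma>'(4) \<tau>'(4) eq assms
      by (simp add: strict_sorted_iff)
    moreover have "v = v'"
      using \<sigma>'(2) \<tau>'(2) eq by simp
    moreover have "u = u'"
      using \<sigma>'(3) \<tau>'(3) eq by simp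
    ultimately show "z = w"
      by (simp add: z w)
  qed
  show "(\<lambda>(\<sigma>, u, v). set v) ` (SIGMA \<sigma>:{\<sigma>. \<sigma> permutes {..<length is}}. I'_set is \<sigma>) = Pow (set is)"
  proof (intro equalityI subsetI)
    fix B assume "B \<in> Pow (set is)"
    then have B: "B \<subseteq> set is" by simp
    then have "set (tuple B) = B"
      using finite_subset by fastforce
    with I'_setI[OF assms B] show
      "B \<in> (\<lambda>(\<sigma>, u, v). set v) ` (SIGMA \<sigma>:{\<sigma>. \<sigma> permutes {..<length is}}. I'_set is \<sigma>)"
      by force
  qed (use I'_setD(1)[OF assms] in fastforce)
qed


section \<open>Finite sums and signs in abelian groups\<close>

lemma (in abelian_monoid) finsum_Sigma:
  assumes "finite A" "\<And>a. a \<in> A \<Longrightarrow> finite (B a)"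
    and f: "\<And>a b. a \<in> A \<Longrightarrow> b \<in> B a \<Longrightarrow> f a b \<in> carrier G"
  shows "(\<Oplus>a\<in>A. \<Oplus>b\<in>B a. f a b) = finsum G (\<lambda>(a, b). f a b) (Sigma A B)"
proof -
  have "finsum G (\<lambda>(a, b). f a b) (Sigma A B) = finsum G (\<lambda>(a, b). f a b) (\<Union>a\<in>A. Pair a ` B a)"
    by (rule arg_cong[where f = "finsum G (\<lambda>(a, b). f a b)"]) auto
  also have "\<dots> = (\<Oplus>a\<in>A. finsum G (\<lambda>(a, b). f a b) (Pair a ` B a))"
    by (rule add.finprod_UN_disjoint) (use assms in \<open>auto simp: pairwise_def disjnt_def\<close>)
  also have "\<dots> = (\<Oplus>a\<in>A. \<Oplus>b\<in>B a. f a b)"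
  proof (rule finsum_cong')
    fix a assume "a \<in> A"
    then show "finsum G (\<lambda>(a, b). f a b) (Pair a ` B a) = (\<Oplus>b\<in>B a. f a b)"
      using f by (subst finsum_reindex) (auto intro: inj_onI)
  qed (use f in \<open>auto intro!: finsum_closed\<close>)
  finally show ?thesis by simp
qed

lemma (in abelian_monoid) finsum_bij_betw:
  assumes "bij_betw h A B" "\<And>b. b \<in> B \<Longrightarrow> g b \<in> carrier G" "\<And>a. a \<in> A \<Longrightarrow> f a = g (h a)"
  shows "finsum G f A = finsum G g B"
proof -
  have "finsum G g (h ` A) = (\<Oplus>a\<in>A. g (h a))"
    by (rule finsum_reindex) (use assms(1,2) in \<open>auto simp: bij_betw_def\<close>)
  also have "\<dots> = finsum G f A"
    by (rule finsum_cong') (use assms in \<open>auto simp: bij_betw_def\<close>)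
  finally show ?thesis
    using assms(1) by (simp add: bij_betw_def)
qed

lemma (in abelian_group_hom) hom_finsum:
  "f \<in> A \<rightarrow> carrier G \<Longrightarrow> h (finsum G f A) = (\<Oplus>\<^bsub>H\<^esub>a\<in>A. h (f a))"
proof (induction A rule: infinite_finite_induct)
  case (insert a A)
  then show ?case
    by (simp add: Pi_iff)
qed simp_all

text \<open>
  The function \<open>signed\<close> is typed for records of modules, so its algebra needs a locale with exactly
  that record type.
\<close>

locale module_component = module K M for K :: "'k ring" and M :: "('k, 'a) module"
begin

lemma signed_closed [simp]: "y \<in> carrier M \<Longrightarrow> signed M s y \<in> carrier M"
  by (simp add: signed_def)

lemma signed_signed: "y \<in> carrier M \<Longrightarrow> signed M s (signed M t y) = signed M (s + t) y"
  by (simp add: signed_def)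

lemma signed_add:
  "y \<in> carrier M \<Longrightarrow> z \<in> carrier M \<Longrightarrow> signed M s (y \<oplus>\<^bsub>M\<^esub> z) = signed M s y \<oplus>\<^bsub>M\<^esub> signed M s z"
  by (simp add: signed_def M.minus_add)

lemma abelian_group_hom_signed: "abelian_group_hom M M (signed M s)"
  by (intro abelian_group_homI group_hom.intro group_hom_axioms.intro M.abelian_group_axioms
      M.a_group homI) (auto simp: signed_add)

lemma signed_finsum:
  "f \<in> A \<rightarrow> carrier M \<Longrightarrow> signed M s (finsum M f A) = (\<Oplus>\<^bsub>M\<^esub>a\<in>A. signed M s (f a))"
  by (rule abelian_group_hom.hom_finsum[OF abelian_group_hom_signed])

end

lemma signed_cong: "even s \<longleftrightarrow> even t \<Longrightarrow> signed M s y = signed M t y"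
  by (simp add: signed_def)

lemma signed_0 [simp]: "signed M 0 y = y"
  by (simp add: signed_def)

lemma hom_signed:
  assumes "abelian_group_hom M N h" "x \<in> carrier M"
  shows "h (signed M s x) = signed N s (h x)"
proof -
  interpret abelian_group_hom M N h by fact
  show ?thesis
    using assms(2) by (simp add: signed_def)
qed

lemma K_linear_closed: "K_linear K M N \<phi> \<Longrightarrow> x \<in> carrier M \<Longrightarrow> \<phi> x \<in> carrier N"
  by (auto simp: K_linear_def)

lemma K_linear_hom:
  assumes "K_linear K M N \<phi>" "module K M" "module K N"
  shows "abelian_group_hom M N \<phi>"
  using assms unfolding K_linear_def module_def
  by (intro abelian_group_homI group_hom.intro group_hom_axioms.intro homI)
     (auto intro: abelian_group.a_group)

lemma K_linear_comp:
  "K_linear K M N \<phi> \<Longrightarrow> K_linear K N P \<psi> \<Longrightarrow> K_linear K M P (\<lambda>x. \<psi> (\<phi> x))"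
  by (auto simp: K_linear_def Pi_iff)

lemma K_linear_signed:
  assumes "module K N" "K_linear K M N \<phi>"
  shows "K_linear K M N (\<lambda>x. signed N s (\<phi> x))"
proof -
  interpret N: module_component K N
    by (rule module_component.intro) fact
  show ?thesis
    using assms(2) by (auto simp: K_linear_def Pi_iff N.signed_add)
      (auto simp: signed_def N.smult_r_minus)
qed

lemma K_linear_finsum:
  assumes "module K M" "module K N" "finite I" "\<And>i. i \<in> I \<Longrightarrow> K_linear K M N (\<phi> i)"
  shows "K_linear K M N (\<lambda>x. \<Oplus>\<^bsub>N\<^esub>i\<in>I. \<phi> i x)"
proof -
  interpret M: module K M by fact
  interpret N: module K N by fact
  show ?thesis
    using assms(3,4)
  proof (induction I rule: finite_induct)
    case empty
    then show ?case
      by (auto simp: K_linear_def N.smult_r_null)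
  next
    case (insert i I)
    have closed: "\<phi> j x \<in> carrier N" if "j \<in> insert i I" "x \<in> carrier M" for j x
      using insert.prems[OF that(1)] that(2) by (rule K_linear_closed)
    have "K_linear K M N (\<lambda>x. \<phi> i x \<oplus>\<^bsub>N\<^esub> (\<Oplus>\<^bsub>N\<^esub>i\<in>I. \<phi> i x))"
      using insert.prems[of i] insert.IH insert.prems
      by (auto simp: K_linear_def Pi_iff N.a_ac N.smult_r_distr)
    moreover have "(\<Oplus>\<^bsub>N\<^esub>i\<in>insert i I. \<phi> i x) = \<phi> i x \<oplus>\<^bsub>N\<^esub> (\<Oplus>\<^bsub>N\<^esub>i\<in>I. \<phi> i x)"
      if "x \<in> carrier M" for x
      using insert.hyps closed that by (subst N.finsum_insert) auto
    ultimately show ?case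
      by (simp add: K_linear_def Pi_iff)
  qed
qed

section \<open>The convolution product\<close>

type_synonym ('a, 'b) family = "nat set \<Rightarrow> nat \<Rightarrow> int \<Rightarrow> 'a \<Rightarrow> 'b"

text \<open>
  The sets underlying index tuples for source degree \<open>n\<close>. Of the subsets of \<open>{0, \<dots>, n}\<close> only the
  full one is excluded, because the target degree \<open>n - card S\<close> must not become negative.
\<close>

definition admissible :: "nat \<Rightarrow> nat set \<Rightarrow> bool" where
  "admissible n S \<longleftrightarrow> S \<subseteq> {..n} \<and> card S \<le> n"

definition linear_family ::
  "'k ring \<Rightarrow> (nat \<Rightarrow> int \<Rightarrow> ('k, 'a) module) \<Rightarrow> (nat \<Rightarrow> int \<Rightarrow> ('k, 'b) module) \<Rightarrow> int \<Rightarrow>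
   ('a, 'b) family \<Rightarrow> bool" where
  "linear_family K X Y e \<phi> \<longleftrightarrow> (\<forall>n m S. admissible n S \<longrightarrow>
     K_linear K (X n m) (Y (n - card S) (m + int (card S) + e)) (\<phi> S n m))"

text \<open>
  The convolution product of families of degrees \<open>e\<close> and \<open>e'\<close>. Morphisms have degree \<open>0\<close>, the
  differential together with the faces has degree \<open>-1\<close>; the degrees determine in which
  bidegree the outer map and the sum are taken.
\<close>

definition conv ::
  "(nat \<Rightarrow> int \<Rightarrow> ('k, 'c) module) \<Rightarrow> int \<Rightarrow> int \<Rightarrow> ('b, 'c) family \<Rightarrow> ('a, 'b) family \<Rightarrow>
   ('a, 'c) family" where
  "conv Z e e' \<phi> \<psi> S n m x =
     (let M = Z (n - card S) (m + int (card S) + (e + e')) in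
      \<Oplus>\<^bsub>M\<^esub>B\<in>Pow S. signed M (int (crossings (S - B) B))
        (\<phi> (rank_outside B ` (S - B)) (n - card B) (m + int (card B) + e') (\<psi> B n m x)))"

lemma admissible_finite: "admissible n S \<Longrightarrow> finite S"
  unfolding admissible_def by (metis finite_atMost finite_subset)

lemma admissible_subset: "admissible n S \<Longrightarrow> B \<subseteq> S \<Longrightarrow> admissible n B"
  using card_mono[OF admissible_finite, of n S B] by (auto simp: admissible_def)

lemma card_rank_outside_image:
  "finite A \<Longrightarrow> A \<inter> B = {} \<Longrightarrow> card (rank_outside B ` A) = card A"
  by (rule card_image[OF inj_on_rank_outside])

lemma card_rank_outside_Diff:
  assumes "finite S" "B \<subseteq> S"
  shows "card (rank_outside B ` (S - B)) = card S - card B" "card B \<le> card S"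
proof -
  have "finite B" using assms finite_subset by auto
  then show "card (rank_outside B ` (S - B)) = card S - card B"
    using assms by (subst card_rank_outside_image) (auto simp: card_Diff_subset)
  show "card B \<le> card S"
    using assms by (rule card_mono)
qed

lemma admissible_rank_outside:
  assumes "admissible n S" "B \<subseteq> S" "A \<subseteq> S - B"
  shows "admissible (n - card B) (rank_outside B ` A)"
proof -
  have fin: "finite S" "finite A" "finite B"
    using admissible_finite[OF assms(1)] assms(2,3) by (meson finite_Diff finite_subset)+
  have "card (rank_outside B ` A) = card A"
    using assms(3) fin by (intro card_rank_outside_image) auto
  also have "card A + card B = card (A \<union> B)"
    using assms(3) fin by (subst card_Un_disjoint) auto
  then have "card A + card B \<le> n"
    using card_mono[OF fin(1), of "A \<union> B"] assms by (auto simp: admissible_def subset_iff)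
  moreover have "rank_outside B ` A \<subseteq> {..n - card B}"
    using assms by (auto simp: admissible_def intro!: rank_outside_bound)
  ultimately show ?thesis
    by (auto simp: admissible_def \<open>card (rank_outside B ` A) = card A\<close>)
qed

lemma linear_familyD:
  "linear_family K X Y e \<phi> \<Longrightarrow> admissible n S \<Longrightarrow> p = n - card S \<Longrightarrow> q = m + int (card S) + e \<Longrightarrow>
   K_linear K (X n m) (Y p q) (\<phi> S n m)"
  by (simp add: linear_family_def)

lemma conv_summand_linear:
  assumes "linear_family K Y Z e \<phi>" "linear_family K X Y e' \<psi>" "admissible n S" "B \<subseteq> S"
  shows "K_linear K (X n m) (Z (n - card S) (m + int (card S) + (e + e')))
    (\<lambda>x. \<phi> (rank_outside B ` (S - B)) (n - card B) (m + int (card B) + e') (\<psi> B n m x))"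
proof -
  have fin: "finite S" "finite B"
    using admissible_finite[OF assms(3)] assms(4) finite_subset by auto
  have card: "card (rank_outside B ` (S - B)) = card S - card B" "card B \<le> card S"
    using card_rank_outside_Diff[OF fin(1) assms(4)] .
  have "K_linear K (X n m) (Y (n - card B) (m + int (card B) + e')) (\<psi> B n m)"
    by (rule linear_familyD[OF assms(2) admissible_subset[OF assms(3,4)]]) simp_all
  moreover have "K_linear K (Y (n - card B) (m + int (card B) + e'))
      (Z (n - card S) (m + int (card S) + (e + e')))
      (\<phi> (rank_outside B ` (S - B)) (n - card B) (m + int (card B) + e'))"
    by (rule linear_familyD[OF assms(1) admissible_rank_outside[OF assms(3,4) order_refl]])
       (use card assms(3) in \<open>simp_all add: admissible_def\<close>)
  ultimately show ?thesis
    by (rule K_linear_comp)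
qed

lemma linear_family_conv:
  assumes "bigraded_module K X" "bigraded_module K Z"
    and "linear_family K Y Z e \<phi>" "linear_family K X Y e' \<psi>"
  shows "linear_family K X Z (e + e') (conv Z e e' \<phi> \<psi>)"
  unfolding linear_family_def
proof (intro allI impI)
  fix n m S assume S: "admissible n S"
  have "K_linear K (X n m) (Z (n - card S) (m + int (card S) + (e + e')))
    (\<lambda>x. conv Z e e' \<phi> \<psi> S n m x)"
    unfolding conv_def Let_def
    by (intro K_linear_finsum K_linear_signed bigraded_module.component_module[OF assms(1)]
        bigraded_module.component_module[OF assms(2)] conv_summand_linear[OF assms(3,4) S])
       (auto simp: admissible_finite[OF S])
  then show "K_linear K (X n m) (Z (n - card S) (m + int (card S) + (e + e')))
    (conv Z e e' \<phi> \<psi> S n m)"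
    by simp
qed

lemma conv_cong:
  assumes "bigraded_module K Z"
    and "linear_family K Y Z e \<phi>" "linear_family K X Y e' \<psi>"
    and "admissible n S" "x \<in> carrier (X n m)"
    and \<phi>: "\<And>n m S y. admissible n S \<Longrightarrow> y \<in> carrier (Y n m) \<Longrightarrow> \<phi>' S n m y = \<phi> S n m y"
    and \<psi>: "\<And>B. admissible n B \<Longrightarrow> \<psi>' B n m x = \<psi> B n m x"
  shows "conv Z e e' \<phi>' \<psi>' S n m x = conv Z e e' \<phi> \<psi> S n m x"
proof -
  interpret module_component K "Z (n - card S) (m + int (card S) + (e + e'))"
    by (rule module_component.intro, rule bigraded_module.component_module[OF assms(1)])
  show ?thesis
    unfolding conv_def Let_def
  proof (rule finsum_cong')
    fix B assume "B \<in> Pow S"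
    then have B: "B \<subseteq> S" by simp
    have "\<psi> B n m x \<in> carrier (Y (n - card B) (m + int (card B) + e'))"
      by (rule K_linear_closed[OF linear_familyD[OF assms(3) admissible_subset[OF assms(4) B]]])
         (simp_all add: assms(5))
    then show "signed (Z (n - card S) (m + int (card S) + (e + e'))) (int (crossings (S - B) B))
          (\<phi>' (rank_outside B ` (S - B)) (n - card B) (m + int (card B) + e') (\<psi>' B n m x)) =
        signed (Z (n - card S) (m + int (card S) + (e + e'))) (int (crossings (S - B) B))
          (\<phi> (rank_outside B ` (S - B)) (n - card B) (m + int (card B) + e') (\<psi> B n m x))"
      by (simp only: \<psi>[OF admissible_subset[OF assms(4) B]]
          \<phi>[OF admissible_rank_outside[OF assms(4) B order_refl]])
  next
    show "(\<lambda>B. signed (Z (n - card S) (m + int (card S) + (e + e'))) (int (crossings (S - B) B))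
          (\<phi> (rank_outside B ` (S - B)) (n - card B) (m + int (card B) + e') (\<psi> B n m x)))
        \<in> Pow S \<rightarrow> carrier (Z (n - card S) (m + int (card S) + (e + e')))"
    proof (rule funcsetI, rule signed_closed)
      fix B assume "B \<in> Pow S"
      then have "B \<subseteq> S" by simp
      show "\<phi> (rank_outside B ` (S - B)) (n - card B) (m + int (card B) + e') (\<psi> B n m x)
          \<in> carrier (Z (n - card S) (m + int (card S) + (e + e')))"
        by (rule K_linear_closed[OF conv_summand_linear[OF assms(2,3,4) \<open>B \<subseteq> S\<close>] assms(5)])
    qed
  qed simp
qed

text \<open>
  The two ways to cut \<open>S\<close> into three ordered blocks: first split off the last two blocks \<open>U\<close> and
  then \<open>C \<subseteq> U\<close>, or first split off the last block \<open>C\<close> and then the middle block from the rest.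
\<close>

lemma bij_betw_nested_subsets:
  "bij_betw (\<lambda>(U, C). (C, U - C)) (SIGMA U:Pow S. Pow U) (SIGMA C:Pow S. Pow (S - C))"
  by (rule bij_betw_byWitness[where f' = "\<lambda>(C, B). (C \<union> B, C)"]) auto

text \<open>
  Both sides are expanded into the same double sum over the last block \<open>C\<close> and the middle block \<open>B\<close>.
  On the left, linearity of \<open>\<chi>\<close> pulls the inner sum out. On the right, the inner sum runs over subsets
  of the hatted set \<open>rank_outside C ` (S - C)\<close>, which are the images of the subsets of \<open>S - C\<close>.
\<close>

theorem conv_assoc:
  assumes "bigraded_module K Y" "bigraded_module K Z" "bigraded_module K W"
    and \<chi>: "linear_family K Z W e\<^sub>3 \<chi>"
    and \<phi>: "linear_family K Y Z e\<^sub>2 \<phi>"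
    and \<psi>: "linear_family K X Y e\<^sub>1 \<psi>"
    and S: "admissible n S" and x: "x \<in> carrier (X n m)"
  shows "conv W e\<^sub>3 (e\<^sub>2 + e\<^sub>1) \<chi> (conv Z e\<^sub>2 e\<^sub>1 \<phi> \<psi>) S n m x
       = conv W (e\<^sub>3 + e\<^sub>2) e\<^sub>1 (conv W e\<^sub>3 e\<^sub>2 \<chi> \<phi>) \<psi> S n m x"
proof -
  define L where "L = W (n - card S) (m + int (card S) + (e\<^sub>3 + (e\<^sub>2 + e\<^sub>1)))"
  interpret L: module_component K L
    unfolding L_def by (rule module_component.intro, rule bigraded_module.component_module[OF assms(3)])
  have fin: "finite S" by (rule admissible_finite[OF S])
  \<comment> \<open>the term of the partition into \<open>S - (B \<union> C)\<close>, \<open>B\<close>, \<open>C\<close>, and the exponent of its sign\<close>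
  define T where "T C B = \<chi> (rank_outside (B \<union> C) ` (S - (B \<union> C))) (n - card (B \<union> C))
      (m + int (card (B \<union> C)) + (e\<^sub>2 + e\<^sub>1))
      (\<phi> (rank_outside C ` B) (n - card C) (m + int (card C) + e\<^sub>1) (\<psi> C n m x))" for B C
  define sgn where "sgn C B = int (crossings (S - (B \<union> C)) (B \<union> C)) + int (crossings B C)" for B C
  have \<phi>\<psi>: "\<phi> (rank_outside C ` (U - C)) (n - card C) (m + int (card C) + e\<^sub>1) (\<psi> C n m x)
      \<in> carrier (Z (n - card U) (m + int (card U) + (e\<^sub>2 + e\<^sub>1)))" if "C \<subseteq> U" "U \<subseteq> S" for C U
    by (rule K_linear_closed[OF conv_summand_linear[OF \<phi> \<psi> admissible_subset[OF S that(2)] that(1)] x])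
  have \<chi>_lin: "K_linear K (Z (n - card U) (m + int (card U) + (e\<^sub>2 + e\<^sub>1))) L
      (\<chi> (rank_outside U ` (S - U)) (n - card U) (m + int (card U) + (e\<^sub>2 + e\<^sub>1)))" if "U \<subseteq> S" for U
  proof -
    show ?thesis
      using card_rank_outside_Diff[OF fin that]
      unfolding L_def using S
      by (intro linear_familyD[OF \<chi>] admissible_rank_outside[OF S that order_refl])
         (auto simp: admissible_def)
  qed
  have T: "T C B \<in> carrier L" if "C \<subseteq> S" "B \<subseteq> S - C" for B C
  proof -
    have eq: "B \<union> C - C = B" using that by auto
    have "\<chi> (rank_outside (B \<union> C) ` (S - (B \<union> C))) (n - card (B \<union> C))
      (m + int (card (B \<union> C)) + (e\<^sub>2 + e\<^sub>1))
      (\<phi> (rank_outside C ` (B \<union> C - C)) (n - card C) (m + int (card C) + e\<^sub>1) (\<psi> C n m x)) \<in> carrier L"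
      by (rule K_linear_closed[OF \<chi>_lin \<phi>\<psi>]) (use that in auto)
    then show ?thesis
      by (simp add: T_def eq)
  qed
  have lhs: "signed L (int (crossings (S - U) U))
       (\<chi> (rank_outside U ` (S - U)) (n - card U) (m + int (card U) + (e\<^sub>2 + e\<^sub>1))
          (conv Z e\<^sub>2 e\<^sub>1 \<phi> \<psi> U n m x))
     = (\<Oplus>\<^bsub>L\<^esub>C\<in>Pow U. signed L (sgn C (U - C)) (T C (U - C)))"
    if U: "U \<subseteq> S" for U
  proof -
    let ?\<chi> = "\<chi> (rank_outside U ` (S - U)) (n - card U) (m + int (card U) + (e\<^sub>2 + e\<^sub>1))"
    let ?Z = "Z (n - card U) (m + int (card U) + (e\<^sub>2 + e\<^sub>1))"
    interpret Z: module_component K ?Z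
      by (rule module_component.intro, rule bigraded_module.component_module[OF assms(2)])
    interpret h: abelian_group_hom ?Z L ?\<chi>
      by (rule K_linear_hom[OF \<chi>_lin[OF U]]) (intro Z.module_axioms L.module_axioms)+
    have CU: "U - C \<union> C = U" if "C \<subseteq> U" for C using that by auto
    have T': "?\<chi> (\<phi> (rank_outside C ` (U - C)) (n - card C) (m + int (card C) + e\<^sub>1) (\<psi> C n m x))
        = T C (U - C)" if "C \<subseteq> U" for C
      unfolding T_def CU[OF that] ..
    have TL: "T C (U - C) \<in> carrier L" if "C \<subseteq> U" for C
      using that U by (intro T) auto
    have "?\<chi> (conv Z e\<^sub>2 e\<^sub>1 \<phi> \<psi> U n m x)
        = (\<Oplus>\<^bsub>L\<^esub>C\<in>Pow U. signed L (int (crossings (U - C) C)) (T C (U - C)))"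
      unfolding conv_def Let_def using U
      by (subst h.hom_finsum) (auto intro!: L.finsum_cong' L.signed_closed Z.signed_closed \<phi>\<psi> TL
           simp: hom_signed[OF h.abelian_group_hom_axioms] \<phi>\<psi> T')
    also have "signed L (int (crossings (S - U) U)) \<dots>
        = (\<Oplus>\<^bsub>L\<^esub>C\<in>Pow U. signed L (sgn C (U - C)) (T C (U - C)))"
      using U by (subst L.signed_finsum)
        (auto intro!: L.finsum_cong' TL simp: L.signed_signed TL sgn_def Un_absorb2)
    finally show ?thesis .
  qed
  have rhs: "signed L (int (crossings (S - C) C))
       (conv W e\<^sub>3 e\<^sub>2 \<chi> \<phi> (rank_outside C ` (S - C)) (n - card C) (m + int (card C) + e\<^sub>1) (\<psi> C n m x))
     = (\<Oplus>\<^bsub>L\<^esub>B\<in>Pow (S - C). signed L (sgn C B) (T C B))"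
    if C: "C \<subseteq> S" for C
  proof -
    have finC: "finite C" using C fin finite_subset by auto
    have card: "card (rank_outside C ` (S - C)) = card S - card C" "card C \<le> card S"
      using card_rank_outside_Diff[OF fin C] .
    have L_eq: "W (n - card C - card (rank_outside C ` (S - C)))
        (m + int (card C) + e\<^sub>1 + int (card (rank_outside C ` (S - C))) + (e\<^sub>3 + e\<^sub>2)) = L"
      using card S unfolding L_def admissible_def
      by (intro arg_cong2[where f = W]) auto
    have "conv W e\<^sub>3 e\<^sub>2 \<chi> \<phi> (rank_outside C ` (S - C)) (n - card C) (m + int (card C) + e\<^sub>1) (\<psi> C n m x)
      = (\<Oplus>\<^bsub>L\<^esub>B\<in>Pow (S - C). signed L (int (crossings (S - (B \<union> C)) B)) (T C B))"
      unfolding conv_def Let_def L_eq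
    proof (rule L.finsum_bij_betw[symmetric])
      show "bij_betw ((`) (rank_outside C)) (Pow (S - C)) (Pow (rank_outside C ` (S - C)))"
        by (intro bij_betw_Pow bij_betw_imageI inj_on_rank_outside) auto
    next
      fix B assume "B \<in> Pow (S - C)"
      then have B: "B \<subseteq> S - C" by simp
      then have finB: "finite B" using fin finite_subset by auto
      have cardB: "card (rank_outside C ` B) = card B" "card (B \<union> C) = card B + card C"
        using finB finC B by (auto intro!: card_rank_outside_image card_Un_disjoint)
      have diff: "rank_outside C ` (S - C) - rank_outside C ` B = rank_outside C ` (S - (B \<union> C))"
      proof -
        have "rank_outside C ` (S - C) - rank_outside C ` B = rank_outside C ` (S - C - B)"
          by (rule inj_on_image_set_diff[symmetric, OF inj_on_rank_outside[of "- C"]]) (use B in auto)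
        also have "S - C - B = S - (B \<union> C)" by auto
        finally show ?thesis .
      qed
      have "rank_outside (rank_outside C ` B) ` rank_outside C ` (S - (B \<union> C))
          = rank_outside (B \<union> C) ` (S - (B \<union> C))"
        unfolding image_image
        by (rule image_cong[OF refl], rule rank_outside_rank_outside) (use B in auto)
      moreover have "crossings (rank_outside C ` (S - (B \<union> C))) (rank_outside C ` B)
          = crossings (S - (B \<union> C)) B"
        by (rule crossings_rank_outside) (use B in auto)
      moreover have "n - card C - card B = n - card (B \<union> C)"
        "m + int (card C) + e\<^sub>1 + int (card B) + e\<^sub>2 = m + int (card (B \<union> C)) + (e\<^sub>2 + e\<^sub>1)"
        by (simp_all add: cardB)
      ultimately show "signed L (int (crossings (S - (B \<union> C)) B)) (T C B) =
         signed L (int (crossings (rank_outside C ` (S - C) - rank_outside C ` B) (rank_outside C ` B)))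
          (\<chi> (rank_outside (rank_outside C ` B) ` (rank_outside C ` (S - C) - rank_outside C ` B))
            (n - card C - card (rank_outside C ` B))
            (m + int (card C) + e\<^sub>1 + int (card (rank_outside C ` B)) + e\<^sub>2)
            (\<phi> (rank_outside C ` B) (n - card C) (m + int (card C) + e\<^sub>1) (\<psi> C n m x)))"
        unfolding diff by (simp only: T_def cardB(1))
    next
      fix E assume E: "E \<in> Pow (rank_outside C ` (S - C))"
      have \<psi>C: "\<psi> C n m x \<in> carrier (Y (n - card C) (m + int (card C) + e\<^sub>1))"
        by (rule K_linear_closed[OF linear_familyD[OF \<psi> admissible_subset[OF S C] refl refl] x])
      show "signed L (int (crossings (rank_outside C ` (S - C) - E) E))
          (\<chi> (rank_outside E ` (rank_outside C ` (S - C) - E)) (n - card C - card E)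
            (m + int (card C) + e\<^sub>1 + int (card E) + e\<^sub>2)
            (\<phi> E (n - card C) (m + int (card C) + e\<^sub>1) (\<psi> C n m x))) \<in> carrier L"
        using K_linear_closed[OF conv_summand_linear[OF \<chi> \<phi> admissible_rank_outside[OF S C order_refl]]
            \<psi>C, of E] E unfolding L_eq by auto
    qed
    also have "signed L (int (crossings (S - C) C)) \<dots>
        = (\<Oplus>\<^bsub>L\<^esub>B\<in>Pow (S - C). signed L (sgn C B) (T C B))"
    proof -
      have "signed L (int (crossings (S - C) C))
            (signed L (int (crossings (S - (B \<union> C)) B)) (T C B)) = signed L (sgn C B) (T C B)"
        if B: "B \<subseteq> S - C" for B
      proof -
        have finB: "finite B" using B fin finite_subset by auto
        have "S - C = (S - (B \<union> C)) \<union> B" using B by auto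
        then have "crossings (S - C) C = crossings (S - (B \<union> C)) C + crossings B C"
          using fin finB finC by (metis Diff_disjoint Int_commute Un_Diff_Int crossings_Un_left finite_Diff
            disjoint_iff Diff_iff Un_iff)
        moreover have "crossings (S - (B \<union> C)) (B \<union> C)
            = crossings (S - (B \<union> C)) B + crossings (S - (B \<union> C)) C"
          by (rule crossings_Un_right) (use fin finB finC B in auto)
        ultimately show ?thesis
          using T[OF C B] by (simp add: L.signed_signed sgn_def algebra_simps)
      qed
      then show ?thesis
        using C by (subst L.signed_finsum) (auto intro!: L.finsum_cong' L.signed_closed T)
    qed
    finally show ?thesis .
  qed
  have "conv W e\<^sub>3 (e\<^sub>2 + e\<^sub>1) \<chi> (conv Z e\<^sub>2 e\<^sub>1 \<phi> \<psi>) S n m x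
      = (\<Oplus>\<^bsub>L\<^esub>U\<in>Pow S. \<Oplus>\<^bsub>L\<^esub>C\<in>Pow U. signed L (sgn C (U - C)) (T C (U - C)))"
    unfolding conv_def[of W e\<^sub>3 "e\<^sub>2 + e\<^sub>1"] Let_def L_def[symmetric]
    by (rule L.finsum_cong') (auto simp: lhs intro!: L.finsum_closed L.signed_closed T)
  also have "\<dots> = finsum L (\<lambda>(U, C). signed L (sgn C (U - C)) (T C (U - C))) (SIGMA U:Pow S. Pow U)"
    by (rule L.finsum_Sigma) (use fin in \<open>auto intro!: L.signed_closed T intro: finite_subset\<close>)
  also have "\<dots> = finsum L (\<lambda>(C, B). signed L (sgn C B) (T C B)) (SIGMA C:Pow S. Pow (S - C))"
    by (rule L.finsum_bij_betw[OF bij_betw_nested_subsets]) (auto intro!: L.signed_closed T)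
  also have "\<dots> = (\<Oplus>\<^bsub>L\<^esub>C\<in>Pow S. \<Oplus>\<^bsub>L\<^esub>B\<in>Pow (S - C). signed L (sgn C B) (T C B))"
    by (rule L.finsum_Sigma[symmetric]) (use fin in \<open>auto intro!: L.signed_closed T\<close>)
  also have "\<dots> = conv W (e\<^sub>3 + e\<^sub>2) e\<^sub>1 (conv W e\<^sub>3 e\<^sub>2 \<chi> \<phi>) \<psi> S n m x"
    unfolding conv_def[of W "e\<^sub>3 + e\<^sub>2" e\<^sub>1] Let_def add.assoc[of e\<^sub>3] L_def[symmetric]
    by (rule L.finsum_cong'[symmetric]) (auto simp: rhs intro!: L.finsum_closed L.signed_closed T)
  finally show ?thesis .
qed


section \<open>Sums over shuffles as sums over subsets\<close>

lemma index_tuple_tuple: "admissible n S \<Longrightarrow> index_tuple n (tuple S)"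
  by (auto simp: index_tuple_def admissible_def admissible_finite sorted_tuple)

lemma index_tupleD:
  assumes "index_tuple n is"
  shows "admissible n (set is)" "tuple (set is) = is" "card (set is) = length is"
    "sorted_wrt (<) is"
  using assms
  by (auto simp: index_tuple_def admissible_def tuple_set strict_sorted_iff distinct_card)

lemma tuple_eq_Nil_iff: "finite S \<Longrightarrow> tuple S = [] \<longleftrightarrow> S = {}"
  by (simp add: sorted_list_of_set.sorted_key_list_of_set_eq_Nil_iff)

lemma index_tuple_ball_iff:
  "(\<forall>n is. index_tuple n is \<longrightarrow> P n is) \<longleftrightarrow> (\<forall>n S. admissible n S \<longrightarrow> P n (tuple S))"
  by (metis index_tuple_tuple index_tupleD(1,2))

lemma finite_I'_set: "finite (I'_set is \<sigma>)"
proof (rule finite_subset)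
  show "I'_set is \<sigma> \<subseteq> (\<lambda>m. (take m (hat (permute_list \<sigma> is)), drop m (hat (permute_list \<sigma> is)))) ` {..length is}"
    by (auto simp: I'_set_def Let_def)
qed simp

text \<open>
  Stated for an arbitrary collection \<open>P\<close> of right blocks, because the sums over \<open>I'\<^sub>\<sigma>\<close> range over all
  subsets and those over \<open>I\<^sub>\<sigma>\<close> over the proper nonempty ones.
\<close>

lemma (in abelian_monoid) finsum_shuffles:
  assumes "sorted_wrt (<) is" "P \<subseteq> Pow (set is)"
    and J: "\<And>\<sigma>. \<sigma> permutes {..<length is} \<Longrightarrow> J \<sigma> = {uv \<in> I'_set is \<sigma>. set (snd uv) \<in> P}"
    and H: "\<And>B. B \<in> P \<Longrightarrow>
      H (crossings (set is - B) B mod 2) (tuple (rank_outside B ` (set is - B))) (tuple B) \<in> carrier G"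
  shows "(\<Oplus>\<sigma>\<in>{\<sigma>. \<sigma> permutes {..<length is}}. \<Oplus>uv\<in>J \<sigma>.
            case uv of (u, v) \<Rightarrow> H (inversion_parity (length is) \<sigma>) u v)
       = (\<Oplus>B\<in>P. H (crossings (set is - B) B mod 2)
            (tuple (rank_outside B ` (set is - B))) (tuple B))" (is "?lhs = finsum G ?H P")
proof -
  let ?perms = "{\<sigma>. \<sigma> permutes {..<length is}}"
  have in_P: "set (snd uv) \<in> P" and mem: "(fst uv, snd uv) \<in> I'_set is \<sigma>"
    if "\<sigma> \<in> ?perms" "uv \<in> J \<sigma>" for \<sigma> uv
    using that J by auto
  have H_eq: "(case uv of (u, v) \<Rightarrow> H (inversion_parity (length is) \<sigma>) u v) = ?H (set (snd uv))"
    if "\<sigma> \<in> ?perms" "uv \<in> J \<sigma>" for \<sigma> uv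
  proof -
    have "\<sigma> permutes {..<length is}" using that by simp
    note D = I'_setD[OF assms(1) this mem[OF that]]
    have "H (inversion_parity (length is) \<sigma>) (fst uv) (snd uv) = ?H (set (snd uv))"
      by (rule arg_cong3[where f = H, OF D(5) D(3) D(2)])
    then show ?thesis
      by (simp add: case_prod_beta)
  qed
  have "?lhs = finsum G (\<lambda>(\<sigma>, uv). case uv of (u, v) \<Rightarrow> H (inversion_parity (length is) \<sigma>) u v)
      (Sigma ?perms J)"
  proof (rule finsum_Sigma)
    show "finite ?perms"
      by (rule finite_permutations) simp
    show "finite (J \<sigma>)" if "\<sigma> \<in> ?perms" for \<sigma>
      using that J finite_I'_set by simp
    show "(case uv of (u, v) \<Rightarrow> H (inversion_parity (length is) \<sigma>) u v) \<in> carrier G"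
      if "\<sigma> \<in> ?perms" "uv \<in> J \<sigma>" for \<sigma> uv
      unfolding H_eq[OF that] by (rule H[OF in_P[OF that]])
  qed
  also have "\<dots> = finsum G ?H P"
  proof (rule finsum_bij_betw)
    let ?h = "\<lambda>(\<sigma>, u, v). set v"
    let ?D = "SIGMA \<sigma>:?perms. I'_set is \<sigma>"
    have bij: "bij_betw ?h ?D (Pow (set is))"
      by (rule shuffles_bij_subsets[OF assms(1)])
    have D: "Sigma ?perms J = {z \<in> ?D. ?h z \<in> P}"
      by (auto simp: J)
    show "bij_betw ?h (Sigma ?perms J) P"
      unfolding D
    proof (rule bij_betw_subset[OF bij])
      show "?h ` {z \<in> ?D. ?h z \<in> P} = P"
      proof (intro equalityI subsetI)
        fix B assume B: "B \<in> P"
        then have "B \<in> ?h ` ?D"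
          using bij_betw_imp_surj_on[OF bij] assms(2) by blast
        then obtain z where "z \<in> ?D" "?h z = B"
          by (rule imageE) simp
        with B show "B \<in> ?h ` {z \<in> ?D. ?h z \<in> P}"
          by (intro image_eqI[of _ _ z]) simp_all
      next
        fix B assume "B \<in> ?h ` {z \<in> ?D. ?h z \<in> P}"
        then show "B \<in> P"
          by (rule imageE) simp
      qed
    qed auto
    show "?H B \<in> carrier G" if "B \<in> P" for B
      by (rule H[OF that])
    show "(case z of (\<sigma>, uv) \<Rightarrow> case uv of (u, v) \<Rightarrow> H (inversion_parity (length is) \<sigma>) u v) = ?H (?h z)"
      if "z \<in> Sigma ?perms J" for z
      using that H_eq[of "fst z" "snd z"] by (auto split: prod.split)
  qed
  finally show ?thesis .
qed

lemma I'_set_Pow: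
  assumes "sorted_wrt (<) is" "\<sigma> permutes {..<length is}"
  shows "I'_set is \<sigma> = {uv \<in> I'_set is \<sigma>. set (snd uv) \<in> Pow (set is)}"
proof -
  have "set (snd uv) \<subseteq> set is" if "uv \<in> I'_set is \<sigma>" for uv
    using I'_setD(1)[OF assms, of "fst uv" "snd uv"] that by simp
  then show ?thesis by auto
qed

lemma I_set_proper:
  assumes "sorted_wrt (<) is" "\<sigma> permutes {..<length is}"
  shows "I_set is \<sigma> = {uv \<in> I'_set is \<sigma>. set (snd uv) \<in> Pow (set is) - {{}, set is}}"
proof -
  let ?h = "hat (permute_list \<sigma> is)"
  have bounds: "1 \<le> m \<and> m + 1 \<le> length is \<longleftrightarrow>
      m \<le> length is \<and> length (take m ?h) \<noteq> 0 \<and> length (drop m ?h) \<noteq> 0" for m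
    unfolding length_take length_drop length_hat length_permute_list by linarith
  have proper: "uv \<in> I_set is \<sigma> \<longleftrightarrow> uv \<in> I'_set is \<sigma> \<and> length (fst uv) \<noteq> 0 \<and> length (snd uv) \<noteq> 0" for uv
  proof
    assume "uv \<in> I_set is \<sigma>"
    then obtain m where "uv = (take m ?h, drop m ?h)" "1 \<le> m \<and> m + 1 \<le> length is"
        "sorted_wrt (<) (take m ?h)" "sorted_wrt (<) (drop m ?h)"
      unfolding I_set_def Let_def by blast
    then show "uv \<in> I'_set is \<sigma> \<and> length (fst uv) \<noteq> 0 \<and> length (snd uv) \<noteq> 0"
      unfolding I'_set_def Let_def bounds by auto
  next
    assume "uv \<in> I'_set is \<sigma> \<and> length (fst uv) \<noteq> 0 \<and> length (snd uv) \<noteq> 0"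
    then obtain m where "uv = (take m ?h, drop m ?h)" "m \<le> length is"
        "sorted_wrt (<) (take m ?h)" "sorted_wrt (<) (drop m ?h)"
        and "length (fst uv) \<noteq> 0" "length (snd uv) \<noteq> 0"
      unfolding I'_set_def Let_def by blast
    then have "1 \<le> m \<and> m + 1 \<le> length is"
      unfolding bounds by (simp only: fst_conv snd_conv simp_thms not_False_eq_True)
    then show "uv \<in> I_set is \<sigma>"
      unfolding I_set_def Let_def
      using \<open>uv = _\<close> \<open>sorted_wrt (<) (take m ?h)\<close> \<open>sorted_wrt (<) (drop m ?h)\<close> by blast
  qed
  have left_empty: "fst uv = [] \<longleftrightarrow> set (snd uv) = set is" and right_subset: "set (snd uv) \<subseteq> set is" if "uv \<in> I'_set is \<sigma>" for uv
  proof -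
    have uv: "(fst uv, snd uv) \<in> I'_set is \<sigma>" using that by simp
    show "set (snd uv) \<subseteq> set is"
      using I'_setD(1)[OF assms uv] .
    then show "fst uv = [] \<longleftrightarrow> set (snd uv) = set is"
      using I'_setD(3)[OF assms uv] by (auto simp: tuple_eq_Nil_iff)
  qed
  show ?thesis
  proof (rule Set.set_eqI)
    fix uv
    show "uv \<in> I_set is \<sigma> \<longleftrightarrow> uv \<in> {uv \<in> I'_set is \<sigma>. set (snd uv) \<in> Pow (set is) - {{}, set is}}"
      using proper[of uv] left_empty[of uv] right_subset[of uv]
      by (cases "uv \<in> I'_set is \<sigma>") (simp_all add: conj_comms)
  qed
qed

lemma conv_at_empty:
  assumes "bigraded_module K Z" "\<phi> {} n (m + e') (\<psi> {} n m x) \<in> carrier (Z n (m + (e + e')))"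
  shows "conv Z e e' \<phi> \<psi> {} n m x = \<phi> {} n (m + e') (\<psi> {} n m x)"
proof -
  interpret module K "Z n (m + (e + e'))"
    by (rule bigraded_module.component_module[OF assms(1)])
  show ?thesis
    using assms(2) by (simp add: conv_def)
qed

lemma F_inf_compose_eq_conv:
  assumes "bigraded_module K Z"
    and G: "linear_family K Y Z 0 (\<lambda>S. g (tuple S))" and F: "linear_family K X Y 0 (\<lambda>S. f (tuple S))"
    and "index_tuple n is" "x \<in> carrier (X n m)"
  shows "F_inf_compose Z g f is n m x = conv Z 0 0 (\<lambda>S. g (tuple S)) (\<lambda>S. f (tuple S)) (set is) n m x"
proof -
  note idx = index_tupleD[OF assms(4)]
  define M where "M = Z (n - length is) (m + int (length is))"
  interpret M: module_component K M
    unfolding M_def by (rule module_component.intro, rule bigraded_module.component_module[OF assms(1)])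
  have summand: "g (tuple (rank_outside B ` (set is - B))) (n - card B) (m + int (card B)) (f (tuple B) n m x)
      \<in> carrier M" if "B \<subseteq> set is" for B
    using K_linear_closed[OF conv_summand_linear[OF G F idx(1) that] assms(5)] idx(3) by (simp add: M_def)
  show ?thesis
  proof (cases "is = []")
    case True
    then show ?thesis
      using summand[of "{}"] assms(1) by (simp add: F_inf_compose_def conv_at_empty M_def)
  next
    case False
    have "F_inf_compose Z g f is n m x = (\<Oplus>\<^bsub>M\<^esub>B\<in>Pow (set is).
        signed M (int (crossings (set is - B) B mod 2))
          (g (tuple (rank_outside B ` (set is - B))) (n - length (tuple B)) (m + int (length (tuple B)))
            (f (tuple B) n m x)))"
      unfolding F_inf_compose_def Let_def M_def[symmetric] if_not_P[OF False]
      by (rule M.finsum_shuffles[where H = "\<lambda>p u v. signed M (int p)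
            (g u (n - length v) (m + int (length v)) (f v n m x))",
            OF idx(4) order_refl I'_set_Pow[OF idx(4)]])
         (auto intro!: M.signed_closed summand)
    also have "\<dots> = conv Z 0 0 (\<lambda>S. g (tuple S)) (\<lambda>S. f (tuple S)) (set is) n m x"
      unfolding conv_def Let_def idx(3) add_0_right M_def[symmetric]
      by (rule M.finsum_cong') (auto intro!: M.signed_closed summand signed_cong)
    finally show ?thesis .
  qed
qed

section \<open>Morphisms as intertwiners\<close>

text \<open>
  With the convention \<open>\<partial>\<^sub>( \<^sub>) = d\<close>, the terms \<open>d f\<^sub>S\<close> and \<open>f\<^sub>S d\<close> of \<open>d(f\<^sub>S)\<close> become ordinary summands of
  the convolutions of \<open>f\<close> with this family.
\<close>

definition structure_family ::
  "(nat \<Rightarrow> int \<Rightarrow> 'a \<Rightarrow> 'a) \<Rightarrow> (nat list \<Rightarrow> nat \<Rightarrow> int \<Rightarrow> 'a \<Rightarrow> 'a) \<Rightarrow> ('a, 'a) family" where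
  "structure_family d \<delta> S = (if S = {} then d else \<delta> (tuple S))"

lemma (in F_inf_module) linear_structure_family: "linear_family K X X (- 1) (structure_family d \<delta>)"
  unfolding linear_family_def structure_family_def
proof (intro allI impI)
  fix n m S assume S: "admissible n S"
  show "K_linear K (X n m) (X (n - card S) (m + int (card S) + - 1))
    ((if S = {} then d else \<delta> (tuple S)) n m)"
    using d_linear \<delta>_linear[OF index_tuple_tuple[OF S] _ refl] admissible_finite[OF S]
    by (simp add: tuple_eq_Nil_iff)
qed

lemma rank_outside_empty [simp]: "rank_outside {} = (\<lambda>a. a)"
  by (rule ext) (simp add: rank_outside_def)

lemma (in abelian_monoid) finsum_Pow_split:
  assumes "finite S" "S \<noteq> {}" "\<And>B. B \<subseteq> S \<Longrightarrow> h B \<in> carrier G"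
  shows "finsum G h (Pow S) = h {} \<oplus> (h S \<oplus> finsum G h (Pow S - {{}, S}))"
proof -
  have "Pow S = insert {} (insert S (Pow S - {{}, S}))" by auto
  then have "finsum G h (Pow S) = finsum G h (insert {} (insert S (Pow S - {{}, S})))" by simp
  also have "\<dots> = h {} \<oplus> (h S \<oplus> finsum G h (Pow S - {{}, S}))"
    using assms by (subst finsum_insert) (auto intro!: finsum_insert)
  finally show ?thesis .
qed

lemma (in abelian_group) minus_eq_zero_iff:
  "p \<in> carrier G \<Longrightarrow> q \<in> carrier G \<Longrightarrow> p \<ominus> q = \<zero> \<longleftrightarrow> p = q"
  by (metis a_minus_def add.inv_closed minus_equality r_neg)

text \<open>
  The defining relation, on the left, separates the extreme terms \<open>p, q, r, s\<close> from the sums \<open>A\<close> and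
  \<open>B\<close> over proper splits; on the right each convolution collects its own two extreme terms.
\<close>

lemma (in abelian_group) morphism_equation_rearrange:
  assumes "p \<in> carrier G" "q \<in> carrier G" "r \<in> carrier G" "s \<in> carrier G"
    "A \<in> carrier G" "B \<in> carrier G"
  shows "p \<ominus> q = \<ominus> r \<oplus> s \<oplus> (\<ominus> A \<oplus> B) \<longleftrightarrow> r \<oplus> (p \<oplus> A) = q \<oplus> (s \<oplus> B)"
proof -
  let ?c = "q \<oplus> r \<oplus> A"
  have "(p \<ominus> q) \<oplus> ?c = \<ominus> q \<oplus> (q \<oplus> (r \<oplus> (p \<oplus> A)))"
    using assms by (simp add: a_minus_def a_ac)
  then have "(p \<ominus> q) \<oplus> ?c = r \<oplus> (p \<oplus> A)"
    using assms by (simp add: r_neg1)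
  moreover have "(\<ominus> r \<oplus> s \<oplus> (\<ominus> A \<oplus> B)) \<oplus> ?c
      = \<ominus> r \<oplus> (r \<oplus> (\<ominus> A \<oplus> (A \<oplus> (q \<oplus> (s \<oplus> B)))))"
    using assms by (simp add: a_ac)
  then have "(\<ominus> r \<oplus> s \<oplus> (\<ominus> A \<oplus> B)) \<oplus> ?c = q \<oplus> (s \<oplus> B)"
    using assms by (simp add: r_neg1)
  moreover have "p \<ominus> q = \<ominus> r \<oplus> s \<oplus> (\<ominus> A \<oplus> B) \<longleftrightarrow>
      (p \<ominus> q) \<oplus> ?c = (\<ominus> r \<oplus> s \<oplus> (\<ominus> A \<oplus> B)) \<oplus> ?c"
    using assms by (subst add.right_cancel) auto
  ultimately show ?thesis by simp
qed

text \<open>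
  The maps \<open>f\<^sub>S\<close> have even total degree, so \<open>d(f\<^sub>S) = d f\<^sub>S - f\<^sub>S d\<close>. Splitting the empty and the full
  subset off both convolutions leaves the sums over proper splits, and the terms in which
  \<open>f\<close> is applied first, moved to one side of the relation, make up \<open>D * f\<close>, the others \<open>f * D\<close>.
\<close>

lemma morphism_relation_iff:
  assumes "F_inf_module K X dX \<delta>X" "F_inf_module K Y dY \<delta>Y"
    and F: "linear_family K X Y 0 (\<lambda>S. f (tuple S))"
    and "index_tuple n is" "is \<noteq> []" and k: "k = length is" and x: "x \<in> carrier (X n m)"
  shows "d_of_map dX Y dY k (int k) (f is) n m x =
      \<ominus>\<^bsub>Y (n - k) (m + int k - 1)\<^esub> \<delta>Y is n m (f [] n m x)
      \<oplus>\<^bsub>Y (n - k) (m + int k - 1)\<^esub> f [] (n - k) (m + int k - 1) (\<delta>X is n m x)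
      \<oplus>\<^bsub>Y (n - k) (m + int k - 1)\<^esub>
      (\<Oplus>\<^bsub>Y (n - k) (m + int k - 1)\<^esub>\<sigma>\<in>{\<sigma>. \<sigma> permutes {..<k}}.
       \<Oplus>\<^bsub>Y (n - k) (m + int k - 1)\<^esub>uv\<in>I_set is \<sigma>. case uv of (u, v) \<Rightarrow>
         signed (Y (n - k) (m + int k - 1)) (int (inversion_parity k \<sigma>) + 1)
           (\<delta>Y u (n - length v) (m + int (length v)) (f v n m x)
            \<ominus>\<^bsub>Y (n - k) (m + int k - 1)\<^esub>
            f u (n - length v) (m + int (length v) - 1) (\<delta>X v n m x)))
    \<longleftrightarrow> conv Y (- 1) 0 (structure_family dY \<delta>Y) (\<lambda>S. f (tuple S)) (set is) n m x
      = conv Y 0 (- 1) (\<lambda>S. f (tuple S)) (structure_family dX \<delta>X) (set is) n m x"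
proof -
  interpret X: F_inf_module K X dX \<delta>X by fact
  interpret Y: F_inf_module K Y dY \<delta>Y by fact
  define N where "N = Y (n - k) (m + int k - 1)"
  interpret N: module_component K N
    unfolding N_def by (rule module_component.intro, rule Y.component_module)
  note idx = index_tupleD[OF assms(4)]
  define S where "S = set is"
  have S: "admissible n S" "S \<noteq> {}" "tuple S = is" "card S = k" "finite S" "sorted_wrt (<) is"
    using idx assms(5) k by (auto simp: S_def)
  define P where "P = Pow S - {{}, S}"
  \<comment> \<open>\<open>a\<close> and \<open>b\<close> are the summands of \<open>D * f\<close> and \<open>f * D\<close>\<close>
  define a where "a B = signed N (int (crossings (S - B) B))
    (structure_family dY \<delta>Y (rank_outside B ` (S - B)) (n - card B) (m + int (card B)) (f (tuple B) n m x))" for B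
  define b where "b B = signed N (int (crossings (S - B) B))
    (f (tuple (rank_outside B ` (S - B))) (n - card B) (m + int (card B) - 1) (structure_family dX \<delta>X B n m x))" for B
  have a_closed: "structure_family dY \<delta>Y (rank_outside B ` (S - B)) (n - card B) (m + int (card B)) (f (tuple B) n m x)
      \<in> carrier N" if "B \<subseteq> S" for B
    using K_linear_closed[OF conv_summand_linear[OF Y.linear_structure_family F S(1) that] x]
    by (simp add: N_def S(4))
  have b_closed: "f (tuple (rank_outside B ` (S - B))) (n - card B) (m + int (card B) - 1) (structure_family dX \<delta>X B n m x)
      \<in> carrier N" if "B \<subseteq> S" for B
    using K_linear_closed[OF conv_summand_linear[OF F X.linear_structure_family S(1) that] x]
    by (simp add: N_def S(4))
  have ab: "a B \<in> carrier N" "b B \<in> carrier N" if "B \<subseteq> S" for B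
    using a_closed[OF that] b_closed[OF that] by (simp_all add: a_def b_def)
  have a_ends: "a {} = \<delta>Y is n m (f [] n m x)" "a S = dY (n - k) (m + int k) (f is n m x)"
    using S by (simp_all add: a_def structure_family_def)
  have b_ends: "b {} = f is n (m - 1) (dX n m x)" "b S = f [] (n - k) (m + int k - 1) (\<delta>X is n m x)"
    using S by (simp_all add: b_def structure_family_def)
  have sums: "finsum N a P \<in> carrier N" "finsum N b P \<in> carrier N"
    by (auto intro!: N.finsum_closed ab simp: P_def)
  define H where "H p u v = signed N (int p + 1)
           (\<delta>Y u (n - length v) (m + int (length v)) (f v n m x)
            \<ominus>\<^bsub>N\<^esub> f u (n - length v) (m + int (length v) - 1) (\<delta>X v n m x))" for p u v
  have H: "H (crossings (S - B) B mod 2) (tuple (rank_outside B ` (S - B))) (tuple B)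
      = signed N 1 (a B) \<oplus>\<^bsub>N\<^esub> b B" if "B \<in> P" for B
  proof -
    from that have B: "B \<subseteq> S" "B \<noteq> {}" "S - B \<noteq> {}" "finite B"
      using S(5) finite_subset by (auto simp: P_def)
    then have eqs: "\<delta>Y (tuple (rank_outside B ` (S - B))) = structure_family dY \<delta>Y (rank_outside B ` (S - B))"
      "\<delta>X (tuple B) = structure_family dX \<delta>X B"
      by (auto simp: structure_family_def)
    have "H (crossings (S - B) B mod 2) (tuple (rank_outside B ` (S - B))) (tuple B)
      = signed N (int (crossings (S - B) B) + 1)
         (structure_family dY \<delta>Y (rank_outside B ` (S - B)) (n - card B) (m + int (card B)) (f (tuple B) n m x)
          \<ominus>\<^bsub>N\<^esub> f (tuple (rank_outside B ` (S - B))) (n - card B) (m + int (card B) - 1) (structure_family dX \<delta>X B n m x))"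
      unfolding H_def eqs using B(4) by (simp) (rule signed_cong, simp)
    also have "\<dots> = signed N 1 (a B) \<oplus>\<^bsub>N\<^esub> b B"
      using a_closed[OF B(1)] b_closed[OF B(1)]
      by (simp add: a_def b_def signed_def N.minus_eq N.minus_add)
    finally show ?thesis .
  qed
  have "(\<Oplus>\<^bsub>N\<^esub>\<sigma>\<in>{\<sigma>. \<sigma> permutes {..<length is}}. \<Oplus>\<^bsub>N\<^esub>uv\<in>I_set is \<sigma>. case uv of (u, v) \<Rightarrow>
         H (inversion_parity (length is) \<sigma>) u v)
      = (\<Oplus>\<^bsub>N\<^esub>B\<in>P. H (crossings (set is - B) B mod 2) (tuple (rank_outside B ` (set is - B))) (tuple B))"
  proof (rule N.finsum_shuffles)
    show "I_set is \<sigma> = {uv \<in> I'_set is \<sigma>. set (snd uv) \<in> P}" if "\<sigma> permutes {..<length is}" for \<sigma>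
      using I_set_proper[OF S(6) that] by (simp add: P_def S_def)
    show "H (crossings (set is - B) B mod 2) (tuple (rank_outside B ` (set is - B))) (tuple B) \<in> carrier N"
      if "B \<in> P" for B
      using H[OF that] ab[of B] that by (simp add: S_def[symmetric] P_def)
  qed (auto simp: S P_def S_def)
  also have "\<dots> = (\<Oplus>\<^bsub>N\<^esub>B\<in>P. signed N 1 (a B) \<oplus>\<^bsub>N\<^esub> b B)"
    unfolding S_def[symmetric] by (rule N.finsum_cong') (auto simp: H P_def intro!: N.signed_closed ab)
  also have "\<dots> = (\<Oplus>\<^bsub>N\<^esub>B\<in>P. signed N 1 (a B)) \<oplus>\<^bsub>N\<^esub> finsum N b P"
    by (rule N.finsum_addf) (auto simp: P_def intro!: N.signed_closed ab)
  also have "(\<Oplus>\<^bsub>N\<^esub>B\<in>P. signed N 1 (a B)) = \<ominus>\<^bsub>N\<^esub> finsum N a P"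
    by (subst N.signed_finsum[symmetric]) (auto simp: P_def signed_def intro!: ab)
  finally have sum_eq: "(\<Oplus>\<^bsub>N\<^esub>\<sigma>\<in>{\<sigma>. \<sigma> permutes {..<k}}. \<Oplus>\<^bsub>N\<^esub>uv\<in>I_set is \<sigma>. case uv of (u, v) \<Rightarrow>
         H (inversion_parity k \<sigma>) u v) = \<ominus>\<^bsub>N\<^esub> finsum N a P \<oplus>\<^bsub>N\<^esub> finsum N b P"
    unfolding k .
  have conv1: "conv Y (- 1) 0 (structure_family dY \<delta>Y) (\<lambda>S. f (tuple S)) S n m x
      = a {} \<oplus>\<^bsub>N\<^esub> (a S \<oplus>\<^bsub>N\<^esub> finsum N a P)"
  proof -
    have "conv Y (- 1) 0 (structure_family dY \<delta>Y) (\<lambda>S. f (tuple S)) S n m x = finsum N a (Pow S)"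
      by (simp add: conv_def Let_def S(4) N_def[symmetric] a_def[abs_def])
    then show ?thesis
      unfolding P_def using N.finsum_Pow_split[OF S(5,2) ab(1)] by simp
  qed
  have conv2: "conv Y 0 (- 1) (\<lambda>S. f (tuple S)) (structure_family dX \<delta>X) S n m x
      = b {} \<oplus>\<^bsub>N\<^esub> (b S \<oplus>\<^bsub>N\<^esub> finsum N b P)"
  proof -
    have "conv Y 0 (- 1) (\<lambda>S. f (tuple S)) (structure_family dX \<delta>X) S n m x = finsum N b (Pow S)"
      by (simp add: conv_def Let_def S(4) N_def[symmetric] b_def[abs_def])
    then show ?thesis
      unfolding P_def using N.finsum_Pow_split[OF S(5,2) ab(2)] by simp
  qed
  have lhs: "d_of_map dX Y dY k (int k) (f is) n m x = a S \<ominus>\<^bsub>N\<^esub> b {}"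
    unfolding d_of_map_def N_def[symmetric] a_ends b_ends by simp
  show ?thesis
    unfolding N_def[symmetric] S_def[symmetric] conv1 conv2 lhs sum_eq[unfolded H_def]
      a_ends(1)[symmetric] b_ends(2)[symmetric]
    by (rule N.morphism_equation_rearrange) (use ab sums in auto)
qed

lemma empty_relation_iff:
  assumes "F_inf_module K X dX \<delta>X" "F_inf_module K Y dY \<delta>Y"
    and F: "linear_family K X Y 0 (\<lambda>S. f (tuple S))" and x: "x \<in> carrier (X n m)"
  shows "d_of_map dX Y dY 0 0 (f []) n m x = \<zero>\<^bsub>Y n (m - 1)\<^esub>
    \<longleftrightarrow> conv Y (- 1) 0 (structure_family dY \<delta>Y) (\<lambda>S. f (tuple S)) {} n m x
      = conv Y 0 (- 1) (\<lambda>S. f (tuple S)) (structure_family dX \<delta>X) {} n m x"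
proof -
  interpret X: F_inf_module K X dX \<delta>X by fact
  interpret Y: F_inf_module K Y dY \<delta>Y by fact
  interpret N: module_component K "Y n (m - 1)"
    by (rule module_component.intro, rule Y.component_module)
  have adm: "admissible n {}" by (simp add: admissible_def)
  have "dY n m (f [] n m x) \<in> carrier (Y n (m - 1))" "f [] n (m - 1) (dX n m x) \<in> carrier (Y n (m - 1))"
    using K_linear_closed[OF conv_summand_linear[OF Y.linear_structure_family F adm subset_refl] x]
      K_linear_closed[OF conv_summand_linear[OF F X.linear_structure_family adm subset_refl] x]
    by (simp_all add: structure_family_def)
  then show ?thesis
    using Y.bigraded_module_axioms
    by (simp add: d_of_map_def conv_at_empty structure_family_def N.minus_eq_zero_iff)
qed

lemma linear_family_tuple_iff:
  "linear_family K X Y 0 (\<lambda>S. f (tuple S)) \<longleftrightarrow>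
   (\<forall>n is. index_tuple n is \<longrightarrow> (\<forall>m. K_linear K (X n m) (Y (n - length is) (m + int (length is))) (f is n m)))"
  unfolding index_tuple_ball_iff linear_family_def by (auto simp: admissible_finite)

theorem F_inf_morphism_iff_intertwines:
  assumes "F_inf_module K X dX \<delta>X" "F_inf_module K Y dY \<delta>Y"
  shows "F_inf_morphism K X dX \<delta>X Y dY \<delta>Y f \<longleftrightarrow>
    linear_family K X Y 0 (\<lambda>S. f (tuple S)) \<and>
    (\<forall>n m S x. admissible n S \<longrightarrow> x \<in> carrier (X n m) \<longrightarrow>
      conv Y (- 1) 0 (structure_family dY \<delta>Y) (\<lambda>S. f (tuple S)) S n m x
    = conv Y 0 (- 1) (\<lambda>S. f (tuple S)) (structure_family dX \<delta>X) S n m x)"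
    (is "_ \<longleftrightarrow> ?linear \<and> ?intertwines")
proof
  assume "F_inf_morphism K X dX \<delta>X Y dY \<delta>Y f"
  then interpret F_inf_morphism K X dX \<delta>X Y dY \<delta>Y f .
  have F: ?linear
    using f_linear by (simp add: linear_family_tuple_iff)
  moreover have ?intertwines
  proof (intro allI impI)
    fix n m S x assume S: "admissible n S" and x: "x \<in> carrier (X n m)"
    show "conv Y (- 1) 0 (structure_family dY \<delta>Y) (\<lambda>S. f (tuple S)) S n m x
        = conv Y 0 (- 1) (\<lambda>S. f (tuple S)) (structure_family dX \<delta>X) S n m x"
    proof (cases "S = {}")
      case True
      then show ?thesis
        using empty_relation_iff[where f = f, OF assms F x] f_empty[OF x] by simp
    next
      case False
      then have ne: "tuple S \<noteq> []"
        using admissible_finite[OF S] by (simp add: tuple_eq_Nil_iff)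
      show ?thesis
        using morphism_relation_iff[where f = f, OF assms F index_tuple_tuple[OF S] ne refl x]
          f_relation[OF index_tuple_tuple[OF S] ne refl x] admissible_finite[OF S] by simp
    qed
  qed
  ultimately show "?linear \<and> ?intertwines" ..
next
  assume rhs: "?linear \<and> ?intertwines"
  then have F: ?linear ..
  show "F_inf_morphism K X dX \<delta>X Y dY \<delta>Y f"
  proof (intro F_inf_morphism.intro F_inf_morphism_axioms.intro assms)
    fix n m k and "is" :: "nat list"
    assume "index_tuple n is" "k = length is"
    then show "K_linear K (X n m) (Y (n - k) (m + int k)) (f is n m)"
      using F by (simp add: linear_family_tuple_iff)
  next
    fix x n m assume x: "x \<in> carrier (X n m)"
    then show "d_of_map dX Y dY 0 0 (f []) n m x = \<zero>\<^bsub>Y n (m - 1)\<^esub>"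
      using rhs empty_relation_iff[where f = f, OF assms F x] by (simp add: admissible_def)
  next
    fix n m k x and "is" :: "nat list"
    assume "index_tuple n is" "is \<noteq> []" "k = length is" "x \<in> carrier (X n m)"
    then show "d_of_map dX Y dY k (int k) (f is) n m x =
      \<ominus>\<^bsub>Y (n - k) (m + int k - 1)\<^esub> \<delta>Y is n m (f [] n m x)
      \<oplus>\<^bsub>Y (n - k) (m + int k - 1)\<^esub> f [] (n - k) (m + int k - 1) (\<delta>X is n m x)
      \<oplus>\<^bsub>Y (n - k) (m + int k - 1)\<^esub>
      (\<Oplus>\<^bsub>Y (n - k) (m + int k - 1)\<^esub>\<sigma>\<in>{\<sigma>. \<sigma> permutes {..<k}}.
       \<Oplus>\<^bsub>Y (n - k) (m + int k - 1)\<^esub>uv\<in>I_set is \<sigma>. case uv of (u, v) \<Rightarrow>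
         signed (Y (n - k) (m + int k - 1)) (int (inversion_parity k \<sigma>) + 1)
           (\<delta>Y u (n - length v) (m + int (length v)) (f v n m x)
            \<ominus>\<^bsub>Y (n - k) (m + int k - 1)\<^esub>
            f u (n - length v) (m + int (length v) - 1) (\<delta>X v n m x)))"
      using rhs by (subst morphism_relation_iff[where f = f, OF assms F]) (auto dest: index_tupleD(1))
  qed
qed

lemma K_linear_cong:
  assumes "module K M" "K_linear K M N \<phi>" "\<And>x. x \<in> carrier M \<Longrightarrow> \<psi> x = \<phi> x"
  shows "K_linear K M N \<psi>"
proof -
  interpret module K M by fact
  show ?thesis
    using assms(2,3) by (simp add: K_linear_def Pi_iff)
qed

text \<open>
  Closure under composition is the statement that a product of two intertwiners is an intertwiner,
  which follows from associativity.
\<close>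

theorem F_inf_compose_morphism:
  assumes f: "F_inf_morphism K X dX \<delta>X Y dY \<delta>Y f" and g: "F_inf_morphism K Y dY \<delta>Y Z dZ \<delta>Z g"
  shows "F_inf_morphism K X dX \<delta>X Z dZ \<delta>Z (F_inf_compose Z g f)"
proof -
  interpret f: F_inf_morphism K X dX \<delta>X Y dY \<delta>Y f by fact
  interpret g: F_inf_morphism K Y dY \<delta>Y Z dZ \<delta>Z g by fact
  let ?F = "\<lambda>S. f (tuple S)" and ?G = "\<lambda>S. g (tuple S)" and ?GF = "\<lambda>S. F_inf_compose Z g f (tuple S)"
  let ?DX = "structure_family dX \<delta>X" and ?DY = "structure_family dY \<delta>Y" and ?DZ = "structure_family dZ \<delta>Z"
  note modX = f.X.F_inf_module_axioms and modY = f.Y.F_inf_module_axioms and modZ = g.Y.F_inf_module_axioms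
  note X = f.X.bigraded_module_axioms and Y = f.Y.bigraded_module_axioms and Z = g.Y.bigraded_module_axioms
  note DX = f.X.linear_structure_family and DY = f.Y.linear_structure_family
    and DZ = g.Y.linear_structure_family
  have F: "linear_family K X Y 0 ?F"
    and DF: "\<And>n m S x. admissible n S \<Longrightarrow> x \<in> carrier (X n m) \<Longrightarrow>
      conv Y (- 1) 0 ?DY ?F S n m x = conv Y 0 (- 1) ?F ?DX S n m x"
    using f by (simp_all add: F_inf_morphism_iff_intertwines[OF modX modY])
  have G: "linear_family K Y Z 0 ?G"
    and DG: "\<And>n m S x. admissible n S \<Longrightarrow> x \<in> carrier (Y n m) \<Longrightarrow>
      conv Z (- 1) 0 ?DZ ?G S n m x = conv Z 0 (- 1) ?G ?DY S n m x"
    using g by (simp_all add: F_inf_morphism_iff_intertwines[OF modY modZ])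
  have GF: "linear_family K X Z 0 (conv Z 0 0 ?G ?F)"
    using linear_family_conv[OF X Z G F] by simp
  have GDY: "linear_family K Y Z (- 1) (conv Z 0 (- 1) ?G ?DY)"
    using linear_family_conv[OF Y Z G DY] by simp
  have FDX: "linear_family K X Y (- 1) (conv Y 0 (- 1) ?F ?DX)"
    using linear_family_conv[OF X Y F DX] by simp
  have comp: "?GF S n m x = conv Z 0 0 ?G ?F S n m x" if "admissible n S" "x \<in> carrier (X n m)" for S n m x
    using F_inf_compose_eq_conv[where f = f and g = g, OF Z G F index_tuple_tuple[OF that(1)] that(2)]
      admissible_finite[OF that(1)] by simp
  have "linear_family K X Z 0 ?GF"
    unfolding linear_family_def
  proof (intro allI impI)
    fix n m S assume S: "admissible n S"
    show "K_linear K (X n m) (Z (n - card S) (m + int (card S) + 0)) (F_inf_compose Z g f (tuple S) n m)"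
      by (rule K_linear_cong[OF f.X.component_module linear_familyD[OF GF S refl refl]]) (rule comp[OF S])
  qed
  moreover have "conv Z (- 1) 0 ?DZ ?GF S n m x = conv Z 0 (- 1) ?GF ?DX S n m x"
    if S: "admissible n S" and x: "x \<in> carrier (X n m)" for n m S x
  proof -
    have "conv Z (- 1) 0 ?DZ ?GF S n m x = conv Z (- 1) 0 ?DZ (conv Z 0 0 ?G ?F) S n m x"
      by (rule conv_cong[OF Z DZ GF S x]) (simp_all add: comp x)
    also have "\<dots> = conv Z (- 1) 0 (conv Z (- 1) 0 ?DZ ?G) ?F S n m x"
      using conv_assoc[OF Y Z Z DZ G F S x] by simp
    also have "\<dots> = conv Z (- 1) 0 (conv Z 0 (- 1) ?G ?DY) ?F S n m x"
      by (rule conv_cong[OF Z GDY F S x]) (simp_all add: DG)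
    also have "\<dots> = conv Z 0 (- 1) ?G (conv Y (- 1) 0 ?DY ?F) S n m x"
      using conv_assoc[OF Y Y Z G DY F S x] by simp
    also have "\<dots> = conv Z 0 (- 1) ?G (conv Y 0 (- 1) ?F ?DX) S n m x"
      by (rule conv_cong[OF Z G FDX S x]) (simp_all add: DF x)
    also have "\<dots> = conv Z 0 (- 1) (conv Z 0 0 ?G ?F) ?DX S n m x"
      using conv_assoc[OF X Y Z G F DX S x] by simp
    also have "\<dots> = conv Z 0 (- 1) ?GF ?DX S n m x"
      by (rule conv_cong[OF Z GF DX S x, symmetric]) (simp_all add: comp)
    finally show ?thesis .
  qed
  ultimately show ?thesis
    by (simp add: F_inf_morphism_iff_intertwines[OF modX modZ])
qed


section \<open>Cyclic rotation\<close>

text \<open>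
  The map \<open>i \<mapsto> i - 1\<close> modulo \<open>n + 1\<close> on \<open>{0, \<dots>, n}\<close>. It covers both cases of the cyclic condition: it
  sends \<open>(i\<^sub>1, \<dots>, i\<^sub>k)\<close> to \<open>(i\<^sub>1 - 1, \<dots>, i\<^sub>k - 1)\<close> or, if \<open>i\<^sub>1 = 0\<close>, to \<open>(i\<^sub>2 - 1, \<dots>, i\<^sub>k - 1, n)\<close>.
\<close>

definition rot :: "nat \<Rightarrow> nat \<Rightarrow> nat" where
  "rot n i = (if i = 0 then n else i - 1)"

lemma rot_0 [simp]: "rot n 0 = n" and rot_pos: "i > 0 \<Longrightarrow> rot n i = i - 1"
  by (simp_all add: rot_def)

lemma inj_on_rot: "S \<subseteq> {..n} \<Longrightarrow> inj_on (rot n) S"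
  by (rule inj_on_subset[of _ "{..n}"]) (auto simp: rot_def inj_on_def)

lemma card_rot_image: "S \<subseteq> {..n} \<Longrightarrow> card (rot n ` S) = card S"
  by (rule card_image[OF inj_on_rot])

lemma admissible_rot: "admissible n S \<Longrightarrow> admissible n (rot n ` S)"
  by (auto simp: admissible_def card_rot_image) (auto simp: rot_def split: if_splits)

lemma rank_outside_rot_pos:
  assumes "0 < a" "a \<le> n" "B \<subseteq> {..n}"
  shows "rank_outside (rot n ` B) (rot n a) = card ({..<a} - B - {0})"
proof -
  have "{..<a} - B - {0} = Suc ` ({..<a - 1} - rot n ` B)"
  proof (intro equalityI subsetI)
    fix x assume x: "x \<in> {..<a} - B - {0}"
    then have "x - 1 \<notin> rot n ` B"
      using assms(2) by (auto simp: rot_def split: if_splits) (metis Suc_pred)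
    with x show "x \<in> Suc ` ({..<a - 1} - rot n ` B)"
      by (intro image_eqI[of _ _ "x - 1"]) auto
  next
    fix x assume "x \<in> Suc ` ({..<a - 1} - rot n ` B)"
    then obtain y where "x = Suc y" "y < a - 1" "y \<notin> rot n ` B" by auto
    moreover from this have "Suc y \<notin> B"
      using image_eqI[of y "rot n" "Suc y" B] by (auto simp: rot_def)
    ultimately show "x \<in> {..<a} - B - {0}" by auto
  qed
  then show ?thesis
    using assms(1) by (simp add: rank_outside_def rot_pos card_image)
qed

text \<open>
  If \<open>0 \<in> B\<close>, the value lost below \<open>a\<close> by the shift is the element \<open>0\<close> of \<open>B\<close>, so the rank of \<open>a\<close>
  outside \<open>B\<close> does not change.
\<close>

lemma rank_outside_rot_right:
  assumes "0 \<in> B" "B \<subseteq> {..n}" "a \<le> n" "a \<notin> B"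
  shows "rank_outside (rot n ` B) (rot n a) = rank_outside B a"
proof -
  have "0 < a" using assms by (metis gr0I)
  then have "rank_outside (rot n ` B) (rot n a) = card ({..<a} - B - {0})"
    by (rule rank_outside_rot_pos) fact+
  also have "{..<a} - B - {0} = {..<a} - B"
    using assms(1) by auto
  finally show ?thesis by (simp add: rank_outside_def)
qed

lemma rank_outside_eq_0_iff: "0 \<notin> B \<Longrightarrow> rank_outside B a = 0 \<longleftrightarrow> a = 0"
  by (auto simp: rank_outside_def)

lemma rot_image_lessThan:
  assumes "B \<subseteq> {..n}" "0 \<notin> B" "b \<in> B"
  shows "rot n b < n"
proof -
  have "0 < b" "b \<le> n" using assms by (auto intro!: gr0I)
  then show ?thesis by (simp add: rot_def)
qed

text \<open>
  If \<open>0 \<notin> B\<close>, the rotation survives on ranks, now modulo \<open>n - card B + 1\<close>. The entry \<open>0\<close> moves to the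
  top value \<open>n\<close>, whose rank is \<open>n - card B\<close>.
\<close>

lemma rank_outside_rot_left:
  assumes "0 \<notin> B" "B \<subseteq> {..n}" "a \<le> n"
  shows "rank_outside (rot n ` B) (rot n a) = rot (n - card B) (rank_outside B a)"
proof (cases "a = 0")
  case True
  have "rot n ` B \<subseteq> {..<n}"
    using rot_image_lessThan[OF assms(2,1)] by auto
  then have "rank_outside (rot n ` B) n = n - card (rot n ` B)"
    unfolding rank_outside_def by (subst card_Diff_subset) (auto intro: finite_subset)
  then show ?thesis
    using assms(2) by (simp add: True card_rot_image rank_outside_def)
next
  case False
  then have "rank_outside (rot n ` B) (rot n a) = card ({..<a} - B - {0})"
    by (intro rank_outside_rot_pos) (use assms in auto)
  also have "\<dots> = rank_outside B a - 1"
    unfolding rank_outside_def using False assms(1) by (subst card_Diff_singleton) auto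
  also have "\<dots> = rot (n - card B) (rank_outside B a)"
    using False assms(1) by (simp add: rot_def rank_outside_eq_0_iff)
  finally show ?thesis .
qed

lemma crossings_none: "(\<And>a b. a \<in> A \<Longrightarrow> b \<in> B \<Longrightarrow> a \<le> b) \<Longrightarrow> crossings A B = 0"
  unfolding crossings_def by (rule card_eq_0_iff[THEN iffD2, OF disjI1]) (auto simp: linorder_not_less)

lemma crossings_all: "(\<And>a b. a \<in> A \<Longrightarrow> b \<in> B \<Longrightarrow> b < a) \<Longrightarrow> crossings A B = card A * card B"
  unfolding crossings_def card_cartesian_product[symmetric] by (rule arg_cong[where f = card]) auto

lemma crossings_rot:
  assumes "A \<subseteq> {..n}" "B \<subseteq> {..n}" "0 \<notin> A" "0 \<notin> B"
  shows "crossings (rot n ` A) (rot n ` B) = crossings A B"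
proof (rule crossings_image)
  fix a b assume "a \<in> A" "b \<in> B"
  then have "a \<noteq> 0" "b \<noteq> 0" using assms(3,4) by metis+
  then show "rot n b < rot n a \<longleftrightarrow> b < a"
    by (auto simp: rot_def)
qed (use assms inj_on_rot in auto)

lemma top_notin_rot: "B \<subseteq> {..n} \<Longrightarrow> n \<notin> rot n ` (B - {0})"
proof
  assume B: "B \<subseteq> {..n}"
  assume "n \<in> rot n ` (B - {0})"
  then obtain b where b: "n = rot n b" "b \<in> B - {0}"
    by (rule imageE)
  have "rot n b < n"
    by (rule rot_image_lessThan[OF _ _ b(2)]) (use B in auto)
  with b(1) show False by simp
qed

text \<open>
  Moving \<open>0 \<in> A\<close> to the top \<open>n\<close> makes it cross every element of \<open>B\<close>, while before it crossed none.
\<close>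

lemma crossings_rot_left:
  assumes "A \<subseteq> {..n}" "B \<subseteq> {..n}" "0 \<in> A" "0 \<notin> B"
  shows "crossings (rot n ` A) (rot n ` B) = crossings A B + card B"
proof -
  have fin: "finite A" "finite B" using assms finite_subset by auto
  have A: "A = {0} \<union> (A - {0})" using assms(3) by auto
  have "crossings A B = crossings {0} B + crossings (A - {0}) B"
    by (subst A, rule crossings_Un_left) (use fin in auto)
  moreover have "crossings {0} B = 0"
    by (rule crossings_none) auto
  moreover have "crossings (rot n ` A) (rot n ` B)
      = crossings {n} (rot n ` B) + crossings (rot n ` (A - {0})) (rot n ` B)"
  proof -
    have "rot n ` A = {n} \<union> rot n ` (A - {0})"
      using assms(3) by (subst A) auto
    moreover have "n \<notin> rot n ` (A - {0})"
      by (rule top_notin_rot[OF assms(1)])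
    ultimately show ?thesis
      using crossings_Un_left[of "{n}" "rot n ` (A - {0})" "rot n ` B"] fin by simp
  qed
  moreover have "crossings {n} (rot n ` B) = card B"
    using rot_image_lessThan[OF assms(2,4)] assms(2) by (subst crossings_all) (auto simp: card_rot_image)
  moreover have "crossings (rot n ` (A - {0})) (rot n ` B) = crossings (A - {0}) B"
    by (rule crossings_rot) (use assms in auto)
  ultimately show ?thesis by simp
qed

text \<open>
  Before the rotation, \<open>0 \<in> B\<close> is crossed by every element of \<open>A\<close>; afterwards it has become the top
  \<open>n\<close> and is crossed by none.
\<close>

lemma crossings_rot_right:
  assumes "A \<subseteq> {..n}" "B \<subseteq> {..n}" "0 \<notin> A" "0 \<in> B"
  shows "crossings A B = crossings (rot n ` A) (rot n ` B) + card A"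
proof -
  have fin: "finite A" "finite B" using assms finite_subset by auto
  have B: "B = {0} \<union> (B - {0})" using assms(4) by auto
  have "crossings A B = crossings A {0} + crossings A (B - {0})"
    by (subst B, rule crossings_Un_right) (use fin in auto)
  moreover have "crossings A {0} = card A"
    using assms(3) by (subst crossings_all) (auto intro: gr0I)
  moreover have "crossings (rot n ` A) (rot n ` B)
      = crossings (rot n ` A) {n} + crossings (rot n ` A) (rot n ` (B - {0}))"
  proof -
    have "rot n ` B = {n} \<union> rot n ` (B - {0})"
      using assms(4) by (subst B) auto
    moreover have "n \<notin> rot n ` (B - {0})"
      by (rule top_notin_rot[OF assms(2)])
    ultimately show ?thesis
      using crossings_Un_right[of "rot n ` A" "{n}" "rot n ` (B - {0})"] fin by simp
  qed
  moreover have "crossings (rot n ` A) {n} = 0"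
    using rot_image_lessThan[OF assms(1,3)] by (intro crossings_none) (auto intro: less_imp_le)
  moreover have "crossings (rot n ` A) (rot n ` (B - {0})) = crossings A (B - {0})"
    by (rule crossings_rot) (use assms in auto)
  ultimately show ?thesis by simp
qed

section \<open>Equivariant families\<close>

definition equivariant_family ::
  "(nat \<Rightarrow> int \<Rightarrow> ('k, 'a) module) \<Rightarrow> (nat \<Rightarrow> int \<Rightarrow> 'a \<Rightarrow> 'a) \<Rightarrow>
   (nat \<Rightarrow> int \<Rightarrow> ('k, 'b) module) \<Rightarrow> (nat \<Rightarrow> int \<Rightarrow> 'b \<Rightarrow> 'b) \<Rightarrow> ('a, 'b) family \<Rightarrow> bool" where
  "equivariant_family X tX Y tY \<phi> \<longleftrightarrow>
     (\<forall>n m S x. admissible n S \<longrightarrow> x \<in> carrier (X n m) \<longrightarrow>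
        \<phi> S n m (tX n m x) =
          (if 0 \<in> S
           then signed (Y (n - card S) (m + int (card S))) (int (card S) - 1) (\<phi> (rot n ` S) n m x)
           else tY (n - card S) (m + int (card S)) (\<phi> (rot n ` S) n m x)))"

text \<open>
  The summands for \<open>B \<subseteq> S\<close> and for the rotated block are compared one by one. If \<open>0 \<in> B\<close>, the inner
  map absorbs \<open>t\<close> with sign \<open>card B - 1\<close> and the crossings drop by \<open>card A\<close>. If \<open>0 \<in> A\<close>, the inner map
  passes \<open>t\<close> on, the outer one absorbs it with sign \<open>card A - 1\<close>, and the crossings grow by \<open>card B\<close>.
  Both give \<open>card S - 1\<close> modulo 2. If \<open>0 \<notin> S\<close>, both maps pass \<open>t\<close> on and the crossings stay the same.
\<close>

lemma equivariant_conv: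
  assumes X: "bigraded_module K X" and Y: "bigraded_module K Y" and Z: "bigraded_module K Z"
    and tZ: "\<And>n m. K_linear K (Z n m) (Z n m) (tZ n m)"
    and \<phi>: "linear_family K Y Z 0 \<phi>" "equivariant_family Y tY Z tZ \<phi>"
    and \<psi>: "linear_family K X Y 0 \<psi>" "equivariant_family X tX Y tY \<psi>"
  shows "equivariant_family X tX Z tZ (conv Z 0 0 \<phi> \<psi>)"
  unfolding equivariant_family_def
proof (intro allI impI)
  fix n m S x assume S: "admissible n S" and x: "x \<in> carrier (X n m)"
  define M where "M = Z (n - card S) (m + int (card S))"
  define t where "t = tZ (n - card S) (m + int (card S))"
  interpret M: module_component K M
    unfolding M_def by (rule module_component.intro, rule bigraded_module.component_module[OF Z])
  interpret t: abelian_group_hom M M t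
    unfolding M_def t_def
    by (rule K_linear_hom[OF tZ]) (rule bigraded_module.component_module[OF Z])+
  have Sn: "S \<subseteq> {..n}" "finite S" using S admissible_finite by (auto simp: admissible_def)
  \<comment> \<open>\<open>T B\<close> is the summand of the rotated convolution at the rotated block, \<open>v B\<close> the same without sign\<close>
  define v where "v B = \<phi> (rank_outside (rot n ` B) ` rot n ` (S - B)) (n - card B) (m + int (card B))
      (\<psi> (rot n ` B) n m x)" for B
  define T where "T B = signed M (int (crossings (rot n ` (S - B)) (rot n ` B))) (v B)" for B
  have rot_S: "admissible n (rot n ` S)" "card (rot n ` S) = card S"
    using admissible_rot[OF S] card_rot_image[OF Sn(1)] .
  have rot_B: "card (rot n ` B) = card B" "rot n ` S - rot n ` B = rot n ` (S - B)"
    "admissible n B" "admissible n (rot n ` B)" if "B \<subseteq> S" for B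
  proof -
    show "card (rot n ` B) = card B"
      using that Sn by (intro card_rot_image) auto
    show "rot n ` S - rot n ` B = rot n ` (S - B)"
      by (rule inj_on_image_set_diff[symmetric, OF inj_on_rot[OF Sn(1)]]) (use that in auto)
    show "admissible n B" "admissible n (rot n ` B)"
      using admissible_subset[OF S that] admissible_rot by auto
  qed
  have v_closed: "v B \<in> carrier M" if "B \<subseteq> S" for B
    using K_linear_closed[OF conv_summand_linear[OF \<phi>(1) \<psi>(1) rot_S(1), of "rot n ` B"] x] that
    by (auto simp: v_def rot_B rot_S M_def)
  then have T_closed: "T B \<in> carrier M" if "B \<subseteq> S" for B
    using that by (simp add: T_def)
  have conv_rot: "conv Z 0 0 \<phi> \<psi> (rot n ` S) n m x = finsum M T (Pow S)"
    unfolding conv_def Let_def rot_S add_0_right M_def[symmetric]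
  proof (rule M.finsum_bij_betw[symmetric])
    show "bij_betw ((`) (rot n)) (Pow S) (Pow (rot n ` S))"
      by (intro bij_betw_Pow bij_betw_imageI inj_on_rot Sn) auto
  next
    fix B assume "B \<in> Pow S"
    then show "T B = signed M (int (crossings (rot n ` S - rot n ` B) (rot n ` B)))
         (\<phi> (rank_outside (rot n ` B) ` (rot n ` S - rot n ` B)) (n - card (rot n ` B))
           (m + int (card (rot n ` B))) (\<psi> (rot n ` B) n m x))"
      by (simp add: T_def v_def rot_B)
  next
    fix B' assume "B' \<in> Pow (rot n ` S)"
    then obtain B where B: "B \<subseteq> S" "B' = rot n ` B"
      by (auto elim: subset_imageE)
    show "signed M (int (crossings (rot n ` S - B') B'))
         (\<phi> (rank_outside B' ` (rot n ` S - B')) (n - card B') (m + int (card B')) (\<psi> B' n m x)) \<in> carrier M"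
      using v_closed[OF B(1)] B by (simp add: v_def rot_B)
  qed
  have summand: "signed M (int (crossings (S - B) B))
        (\<phi> (rank_outside B ` (S - B)) (n - card B) (m + int (card B)) (\<psi> B n m (tX n m x)))
      = (if 0 \<in> S then signed M (int (card S) - 1) (T B) else t (T B))" if B: "B \<subseteq> S" for B
  proof -
    let ?A = "S - B"
    let ?R = "rank_outside B ` ?A" and ?y = "\<psi> (rot n ` B) n m x"
    let ?Y = "Y (n - card B) (m + int (card B))"
    have AB: "?A \<subseteq> {..n}" "B \<subseteq> {..n}" "finite B" using Sn B finite_subset by auto
    have cardS: "card S = card ?A + card B"
      using card_mono[OF Sn(2) B] AB(3) B by (simp add: card_Diff_subset)
    have R: "admissible (n - card B) ?R" "card ?R = card ?A"
      using admissible_rank_outside[OF S B order_refl] card_rank_outside_image[of ?A B] Sn(2) by auto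
    have y: "?y \<in> carrier ?Y"
      by (rule K_linear_closed[OF linear_familyD[OF \<psi>(1) rot_B(4)[OF B]] x]) (simp_all add: rot_B(1)[OF B])
    have M_eq: "Z (n - card B - card ?A) (m + int (card B) + int (card ?A)) = M"
      unfolding M_def cardS by (intro arg_cong2[where f = Z]) auto
    have t_eq: "tZ (n - card B - card ?A) (m + int (card B) + int (card ?A)) = t"
      unfolding t_def cardS by (intro arg_cong2[where f = tZ]) auto
    show ?thesis
    proof (cases "0 \<in> B")
      case True
      then have "0 \<in> S" "0 \<notin> ?A" using B by auto
      have "\<psi> B n m (tX n m x) = signed ?Y (int (card B) - 1) ?y"
        using \<psi>(2) rot_B(3)[OF B] x True by (simp add: equivariant_family_def)
      moreover have "rank_outside (rot n ` B) ` rot n ` ?A = ?R"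
        unfolding image_image
        by (rule image_cong[OF refl], rule rank_outside_rot_right) (use True AB in auto)
      then have v: "v B = \<phi> ?R (n - card B) (m + int (card B)) ?y"
        by (simp only: v_def)
      moreover have "abelian_group_hom ?Y M (\<phi> ?R (n - card B) (m + int (card B)))"
        by (rule K_linear_hom[OF linear_familyD[OF \<phi>(1) R(1) refl refl, of "m + int (card B)",
            unfolded add_0_right R(2) M_eq]])
           (rule bigraded_module.component_module[OF Y], rule M.module_axioms)
      ultimately have "\<phi> ?R (n - card B) (m + int (card B)) (\<psi> B n m (tX n m x))
          = signed M (int (card B) - 1) (v B)"
        using y by (simp add: hom_signed)
      then show ?thesis
        using v_closed[OF B] \<open>0 \<in> S\<close> crossings_rot_right[OF AB(1,2) \<open>0 \<notin> ?A\<close> True]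
        by (simp add: T_def M.signed_signed cardS) (rule signed_cong, auto)
    next
      case False
      have "\<psi> B n m (tX n m x) = tY (n - card B) (m + int (card B)) ?y"
        using \<psi>(2) rot_B(3)[OF B] x False by (simp add: equivariant_family_def)
      moreover have "rank_outside (rot n ` B) ` rot n ` ?A = rot (n - card B) ` ?R"
        unfolding image_image
        by (rule image_cong[OF refl], rule rank_outside_rot_left) (use False AB in auto)
      then have v: "v B = \<phi> (rot (n - card B) ` ?R) (n - card B) (m + int (card B)) ?y"
        by (simp only: v_def)
      moreover have "0 \<in> ?R \<longleftrightarrow> 0 \<in> S"
        using False rank_outside_eq_0_iff[OF False] by (force simp: image_iff)
      ultimately have eq: "\<phi> ?R (n - card B) (m + int (card B)) (\<psi> B n m (tX n m x))
          = (if 0 \<in> S then signed M (int (card ?A) - 1) (v B) else t (v B))"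
        using \<phi>(2)[unfolded equivariant_family_def, rule_format, OF R(1) y, unfolded R(2) M_eq t_eq]
        by (simp only:)
      show ?thesis
      proof (cases "0 \<in> S")
        case True
        then have "0 \<in> ?A" using False by simp
        then show ?thesis
          using v_closed[OF B] True crossings_rot_left[OF AB(1,2) _ False]
          by (simp add: eq T_def M.signed_signed cardS) (rule signed_cong, auto)
      next
        case notin: False
        then have "0 \<notin> ?A" by simp
        then show ?thesis
          using v_closed[OF B] notin crossings_rot[OF AB(1,2) _ False]
          by (simp add: eq T_def hom_signed[OF t.abelian_group_hom_axioms])
      qed
    qed
  qed
  have "conv Z 0 0 \<phi> \<psi> S n m (tX n m x)
      = (\<Oplus>\<^bsub>M\<^esub>B\<in>Pow S. if 0 \<in> S then signed M (int (card S) - 1) (T B) else t (T B))"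
    unfolding conv_def Let_def add_0_right M_def[symmetric]
    by (rule M.finsum_cong') (auto simp: summand T_closed)
  also have "\<dots> = (if 0 \<in> S then signed M (int (card S) - 1) (finsum M T (Pow S)) else t (finsum M T (Pow S)))"
    using T_closed by (simp add: M.signed_finsum t.hom_finsum Pi_iff)
  finally show "conv Z 0 0 \<phi> \<psi> S n m (tX n m x) =
      (if 0 \<in> S
       then signed (Z (n - card S) (m + int (card S))) (int (card S) - 1) (conv Z 0 0 \<phi> \<psi> (rot n ` S) n m x)
       else tZ (n - card S) (m + int (card S)) (conv Z 0 0 \<phi> \<psi> (rot n ` S) n m x))"
    by (simp only: conv_rot M_def t_def)
qed

lemma tuple_rot:
  assumes "index_tuple n is" "is \<noteq> []"
  shows "hd is = 0 \<longleftrightarrow> 0 \<in> set is"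
    and "hd is = 0 \<Longrightarrow> tuple (rot n ` set is) = map (\<lambda>i. i - 1) (tl is) @ [n]"
    and "hd is > 0 \<Longrightarrow> tuple (rot n ` set is) = map (\<lambda>i. i - 1) is"
proof -
  obtain i js where "is": "is = i # js" using assms(2) by (cases "is") auto
  have js: "i < j" "0 < j" "j \<le> n" if "j \<in> set js" for j
    using assms(1) that by (auto simp: index_tuple_def "is")
  have sorted: "sorted_wrt (<) js"
    using assms(1) by (simp add: index_tuple_def "is")
  have sorted_pred: "sorted_wrt (<) (map (\<lambda>i. i - 1) js)"
    unfolding sorted_wrt_map by (rule sorted_wrt_mono_rel[OF _ sorted]) (use js in force)
  show "hd is = 0 \<longleftrightarrow> 0 \<in> set is"
    using js by (auto simp: "is")
  have rot_js: "rot n ` set js = (\<lambda>i. i - 1) ` set js"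
    using js(2) by (intro image_cong) (auto simp: rot_def)
  show "tuple (rot n ` set is) = map (\<lambda>i. i - 1) (tl is) @ [n]" if "hd is = 0"
  proof -
    have "rot n ` set is = set (map (\<lambda>i. i - 1) (tl is) @ [n])"
      using that rot_js by (simp add: "is")
    moreover have "sorted_wrt (<) (map (\<lambda>i. i - 1) (tl is) @ [n])"
      using sorted_pred js by (force simp: "is" sorted_wrt_append)
    ultimately show ?thesis
      by (simp only: tuple_set)
  qed
  show "tuple (rot n ` set is) = map (\<lambda>i. i - 1) is" if "hd is > 0"
  proof -
    have "rot n ` set is = set (map (\<lambda>i. i - 1) is)"
      using that rot_js by (simp add: "is" rot_pos)
    moreover have "sorted_wrt (<) (map (\<lambda>i. i - 1) is)"
      using sorted_pred js that by (force simp: "is")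
    ultimately show ?thesis
      by (simp only: tuple_set)
  qed
qed

text \<open>
  Since \<open>rot n\<close> handles \<open>i\<^sub>1 = 0\<close> and \<open>i\<^sub>1 > 0\<close> alike and fixes the empty set, the three cyclic conditions
  merge into one condition on families indexed by sets.
\<close>

theorem CF_inf_morphism_iff_equivariant:
  assumes "CF_inf_module K X dX \<delta>X tX" "CF_inf_module K Y dY \<delta>Y tY"
  shows "CF_inf_morphism K X dX \<delta>X tX Y dY \<delta>Y tY f \<longleftrightarrow>
    F_inf_morphism K X dX \<delta>X Y dY \<delta>Y f \<and> equivariant_family X tX Y tY (\<lambda>S. f (tuple S))"
    (is "_ \<longleftrightarrow> _ \<and> ?equivariant")
proof
  assume "CF_inf_morphism K X dX \<delta>X tX Y dY \<delta>Y tY f"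
  then interpret CF_inf_morphism K X dX \<delta>X tX Y dY \<delta>Y tY f .
  have ?equivariant
    unfolding equivariant_family_def
  proof (intro allI impI)
    fix n m S x assume S: "admissible n S" and x: "x \<in> carrier (X n m)"
    have set: "set (tuple S) = S" "length (tuple S) = card S"
      using admissible_finite[OF S] by auto
    show "f (tuple S) n m (tX n m x) =
        (if 0 \<in> S
         then signed (Y (n - card S) (m + int (card S))) (int (card S) - 1) (f (tuple (rot n ` S)) n m x)
         else tY (n - card S) (m + int (card S)) (f (tuple (rot n ` S)) n m x))"
    proof (cases "S = {}")
      case True
      then show ?thesis using f_t_empty[OF x] by simp
    next
      case False
      then have ne: "tuple S \<noteq> []"
        using admissible_finite[OF S] by (simp add: tuple_eq_Nil_iff)
      note rot = tuple_rot[OF index_tuple_tuple[OF S] ne, unfolded set]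
      show ?thesis
      proof (cases "0 \<in> S")
        case True
        then have "hd (tuple S) = 0" using rot(1) by simp
        then show ?thesis
          using f_t_zero[OF index_tuple_tuple[OF S] ne set(2)[symmetric] _ x] True rot(2) by simp
      next
        case False
        then have "hd (tuple S) > 0" using rot(1) by simp
        then show ?thesis
          using f_t_pos[OF index_tuple_tuple[OF S] ne set(2)[symmetric] _ x] False rot(3) by simp
      qed
    qed
  qed
  then show "F_inf_morphism K X dX \<delta>X Y dY \<delta>Y f \<and> ?equivariant"
    using F_inf_morphism_axioms by simp
next
  assume rhs: "F_inf_morphism K X dX \<delta>X Y dY \<delta>Y f \<and> ?equivariant"
  have eqv: "f is n m (tX n m x) =
        (if 0 \<in> set is
         then signed (Y (n - length is) (m + int (length is))) (int (length is) - 1) (f (tuple (rot n ` set is)) n m x)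
         else tY (n - length is) (m + int (length is)) (f (tuple (rot n ` set is)) n m x))"
    if "index_tuple n is" "x \<in> carrier (X n m)" for n m x and "is" :: "nat list"
    using rhs that(2) index_tupleD[OF that(1)] unfolding equivariant_family_def by metis
  show "CF_inf_morphism K X dX \<delta>X tX Y dY \<delta>Y tY f"
  proof (intro CF_inf_morphism.intro CF_inf_morphism_axioms.intro assms)
    show "F_inf_morphism K X dX \<delta>X Y dY \<delta>Y f" using rhs ..
  next
    fix x n m assume "x \<in> carrier (X n m)"
    then show "f [] n m (tX n m x) = tY n m (f [] n m x)"
      using eqv[of n "[]" x m] by (simp add: index_tuple_def)
  next
    fix n m k x and "is" :: "nat list"
    assume *: "index_tuple n is" "is \<noteq> []" "k = length is" "x \<in> carrier (X n m)"
    {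
      assume "hd is > 0"
      then show "f is n m (tX n m x) = tY (n - k) (m + int k) (f (map (\<lambda>i. i - 1) is) n m x)"
        using eqv[OF *(1,4)] tuple_rot[OF *(1,2)] *(3) by simp
    next
      assume "hd is = 0"
      then show "f is n m (tX n m x) =
          signed (Y (n - k) (m + int k)) (int k - 1) (f (map (\<lambda>i. i - 1) (tl is) @ [n]) n m x)"
        using eqv[OF *(1,4)] tuple_rot[OF *(1,2)] *(3) by simp
    }
  qed
qed

theorem theorem1p1:
  fixes K :: "'k ring"
    and X :: "nat \<Rightarrow> int \<Rightarrow> ('k, 'a) module"
    and Y :: "nat \<Rightarrow> int \<Rightarrow> ('k, 'b) module"
    and Z :: "nat \<Rightarrow> int \<Rightarrow> ('k, 'c) module"
  assumes "cring K"
    and "CF_inf_morphism K X dX \<delta>X tX Y dY \<delta>Y tY f"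
    and "CF_inf_morphism K Y dY \<delta>Y tY Z dZ \<delta>Z tZ g"
  shows "CF_inf_morphism K X dX \<delta>X tX Z dZ \<delta>Z tZ (F_inf_compose Z g f)"
proof -
  interpret f: CF_inf_morphism K X dX \<delta>X tX Y dY \<delta>Y tY f by fact
  interpret g: CF_inf_morphism K Y dY \<delta>Y tY Z dZ \<delta>Z tZ g by fact
  note X = f.X.CF_inf_module_axioms and Y = f.Y.CF_inf_module_axioms and Z = g.Y.CF_inf_module_axioms
  let ?F = "\<lambda>S. f (tuple S)" and ?G = "\<lambda>S. g (tuple S)"
  have F: "linear_family K X Y 0 ?F" "equivariant_family X tX Y tY ?F"
    using f.F_inf_morphism_axioms assms(2)
    by (simp_all add: CF_inf_morphism_iff_equivariant[OF X Y]
        F_inf_morphism_iff_intertwines[OF f.X.F_inf_module_axioms f.Y.F_inf_module_axioms])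
  have G: "linear_family K Y Z 0 ?G" "equivariant_family Y tY Z tZ ?G"
    using g.F_inf_morphism_axioms assms(3)
    by (simp_all add: CF_inf_morphism_iff_equivariant[OF Y Z]
        F_inf_morphism_iff_intertwines[OF f.Y.F_inf_module_axioms g.Y.F_inf_module_axioms])
  have comp: "F_inf_compose Z g f (tuple S) n m x = conv Z 0 0 ?G ?F S n m x"
    if "admissible n S" "x \<in> carrier (X n m)" for S n m x
    using F_inf_compose_eq_conv[where f = f and g = g, OF g.Y.bigraded_module_axioms G(1) F(1)
        index_tuple_tuple[OF that(1)] that(2)] admissible_finite[OF that(1)] by simp
  have "equivariant_family X tX Z tZ (conv Z 0 0 ?G ?F)"
    by (rule equivariant_conv[OF f.X.bigraded_module_axioms f.Y.bigraded_module_axioms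
          g.Y.bigraded_module_axioms g.Y.t_linear G F])
  then have "equivariant_family X tX Z tZ (\<lambda>S. F_inf_compose Z g f (tuple S))"
    unfolding equivariant_family_def
    using comp admissible_rot K_linear_closed[OF f.X.t_linear] by simp
  moreover have "F_inf_morphism K X dX \<delta>X Z dZ \<delta>Z (F_inf_compose Z g f)"
    by (rule F_inf_compose_morphism[OF f.F_inf_morphism_axioms g.F_inf_morphism_axioms])
  ultimately show ?thesis
    by (simp add: CF_inf_morphism_iff_equivariant[OF X Z])
qed

end
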